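(* Let $d\ge 2$. Assume that $W:\mathbb{R}^d\to(-\infty,\infty]$ is locally integrable, bounded below, lower semicontinuous, and radially symmetric, and that the interaction energy $E$ associated to $W$ is LIC. Then every compactly supported $d_\infty$-local minimizer $\rho\in\mathcal{P}(\mathbb{R}^d)$ of $E$ is radially symmetric (about its center of mass). Furthermore, suppose that $E$ is FLIC and that $\rho\in\mathcal{P}(\mathbb{R}^d)$ is a compactly supported steady state of the interaction energy $E$ such that $\nabla^2 W*\rho$ is continuous on $\mathbb{R}^d$ and $\nabla^2 W*\rho\ge 0$ (i.e. is positive semi-definite) on $\operatorname{supp}\rho$. Then $\rho$ is radially symmetric (about its center of mass).
   Context: $\mathcal{P}(\mathbb{R}^d)$ is the set of Borel probability measures on $\mathbb{R}^d$, and $\mathcal{P}_2(\mathbb{R}^d)$ the subset of those with finite second moment. Without loss of generality $W\ge 0$ (add a constant). Interaction energy: $E[\rho]=\frac12\int\int W(x-y)\,d\rho(y)\,d\rho(x)$; the same notation $E[\mu]$ is used for signed measures $\mu$. The potential generated by $\rho$ is $V=W*\rho$; $\nabla^2W*\rho$ denotes the Hessian of $V$. $d_\infty(\mu,\nu)=\inf_{\pi\in\Pi(\mu,\nu)}\sup_{(x,y)\in\operatorname{supp}\pi}|x-y|$ for compactly supported $\mu,\nu$, with $\Pi(\mu,\nu)$ the set of transport plans. $\rho$ is a $d_\infty$-local minimizer if there is $\epsilon>0$ with $E[\rho]\le E[\nu]$ for all compactly supported $\nu\in\mathcal{P}(\mathbb{R}^d)$ with $d_\infty(\rho,\nu)<\epsilon$.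 LIC (linear interpolation convexity): for all $\rho_0\ne\rho_1$ in $\mathcal{P}_2(\mathbb{R}^d)$ with the same center of mass and $E[\rho_0],E[\rho_1]<\infty$, the function $t\mapsto E[(1-t)\rho_0+t\rho_1]$ is strictly convex on $[0,1]$; equivalently, $E[\mu]>0$ for every nonzero finite signed measure $\mu$ (with finite second moment) such that $\int d\mu=0$, $\int x\,d\mu=0$ and $E[|\mu|]<\infty$. FLIC (Fourier linear interpolation convexity): for all $0<r<R<\infty$ there is $c>0$ such that $E[\mu]\ge c\int_{r\le|\xi|\le R}|\hat\mu(\xi)|^2\,d\xi$ for every such signed measure $\mu$ ($\int d\mu=0$, $\int x\,d\mu=0$, $E[|\mu|]<\infty$), where $\hat\mu(\xi)=\int e^{-ix\cdot\xi}d\mu(x)$. Steady state: $\rho\in\mathcal{P}(\mathbb{R}^d)$ is a steady state of $E$ if $0\in\partial V(x)$ for $\rho$-a.e. $x$, where $\partial V$ is the subdifferential of $V=W*\rho$; if $V\in C^1$ this means $\nabla V=0$ on $\operatorname{supp}\rho$. *)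

theory Defs
  imports "HOL-Probability.Probability"
begin

section \<open>Borel probability measures\<close>

definition borel_prob :: "'a::euclidean_space measure set" where
  "borel_prob = {\<rho>. prob_space \<rho> \<and> sets \<rho> = sets borel}"

definition borel_prob2 :: "'a::euclidean_space measure set" where
  "borel_prob2 = {\<rho> \<in> borel_prob. integrable \<rho> (\<lambda>x. (norm x)\<^sup>2)}"

definition center_of_mass :: "'a::euclidean_space measure \<Rightarrow> 'a" where
  "center_of_mass \<rho> = (LINT x|\<rho>. x)"

definition msupp :: "'a::topological_space measure \<Rightarrow> 'a set" where
  "msupp \<rho> = {x. \<forall>U. open U \<and> x \<in> U \<longrightarrow> emeasure \<rho> U > 0}"

definition compactly_supported :: "'a::topological_space measure \<Rightarrow> bool" where
  "compactly_supported \<rho> \<longleftrightarrow> compact (msupp \<rho>)"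

definition radial_about :: "'a::euclidean_space \<Rightarrow> 'a measure \<Rightarrow> bool" where
  "radial_about c \<rho> \<longleftrightarrow>
     (\<forall>f. orthogonal_transformation f \<longrightarrow> distr \<rho> borel (\<lambda>x. c + f (x - c)) = \<rho>)"

text \<open>The Borel measure \<open>a \<mu> + b \<nu>\<close>, for \<open>a, b \<ge> 0\<close>.\<close>

definition mix_measure ::
    "real \<Rightarrow> 'a::euclidean_space measure \<Rightarrow> real \<Rightarrow> 'a measure \<Rightarrow> 'a measure" where
  "mix_measure a \<mu> b \<nu> =
     measure_of UNIV (sets borel) (\<lambda>A. ennreal a * emeasure \<mu> A + ennreal b * emeasure \<nu> A)"

lemma sets_mix_measure [simp]: "sets (mix_measure a \<mu> b \<nu>) = sets borel"
  unfolding mix_measure_def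
  using sets.sigma_sets_eq[of borel] by simp

lemma emeasure_mix_measure:
  assumes "sets \<mu> = sets borel" "sets \<nu> = sets borel" "A \<in> sets borel"
  shows "emeasure (mix_measure a \<mu> b \<nu>) A = ennreal a * emeasure \<mu> A + ennreal b * emeasure \<nu> A"
proof (rule emeasure_measure_of[OF mix_measure_def])
  show "countably_additive (sets (mix_measure a \<mu> b \<nu>))
      (\<lambda>A. ennreal a * emeasure \<mu> A + ennreal b * emeasure \<nu> A)"
  proof (rule countably_additiveI)
    fix F :: "nat \<Rightarrow> 'a set"
    assume "range F \<subseteq> sets (mix_measure a \<mu> b \<nu>)" "disjoint_family F"
    then have "(\<Sum>i. emeasure \<mu> (F i)) = emeasure \<mu> (\<Union>i. F i)"
        "(\<Sum>i. emeasure \<nu> (F i)) = emeasure \<nu> (\<Union>i. F i)"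
      using assms by (auto intro!: suminf_emeasure)
    then show "(\<Sum>i. ennreal a * emeasure \<mu> (F i) + ennreal b * emeasure \<nu> (F i)) =
        ennreal a * emeasure \<mu> (\<Union>i. F i) + ennreal b * emeasure \<nu> (\<Union>i. F i)"
      by (simp add: suminf_add[symmetric] ennreal_suminf_cmult)
  qed
qed (use assms in \<open>auto simp: positive_def\<close>)

section \<open>Interaction energy\<close>

definition lower_semicontinuous :: "('a::euclidean_space \<Rightarrow> ereal) \<Rightarrow> bool" where
  "lower_semicontinuous W \<longleftrightarrow> (\<forall>x. W x \<le> Liminf (at x) W)"

definition locally_integrable :: "('a::euclidean_space \<Rightarrow> ereal) \<Rightarrow> bool" where
  "locally_integrable W \<longleftrightarrow> W \<in> borel_measurable borel \<and>
     (\<forall>K. compact K \<longrightarrow> (\<integral>\<^sup>+x\<in>K. e2ennreal \<bar>W x\<bar> \<partial>lborel) < \<infinity>)"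

definition radial_fun :: "('a::euclidean_space \<Rightarrow> 'b) \<Rightarrow> bool" where
  "radial_fun W \<longleftrightarrow> (\<forall>x y. norm x = norm y \<longrightarrow> W x = W y)"

text \<open>Integral of an extended-real function, positive part minus negative part. It is only
  applied to functions bounded below and finite measures, where the second term is finite.\<close>

definition ext_integral :: "'a measure \<Rightarrow> ('a \<Rightarrow> ereal) \<Rightarrow> ereal" where
  "ext_integral M f =
     enn2ereal (\<integral>\<^sup>+x. e2ennreal (f x) \<partial>M) - enn2ereal (\<integral>\<^sup>+x. e2ennreal (- f x) \<partial>M)"

definition potential :: "('a::euclidean_space \<Rightarrow> ereal) \<Rightarrow> 'a measure \<Rightarrow> 'a \<Rightarrow> ereal" where
  "potential W \<rho> x = ext_integral \<rho> (\<lambda>y. W (x - y))"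

definition interaction ::
    "('a::euclidean_space \<Rightarrow> ereal) \<Rightarrow> 'a measure \<Rightarrow> 'a measure \<Rightarrow> ereal" where
  "interaction W \<mu> \<nu> = ext_integral \<mu> (potential W \<nu>)"

definition energy :: "('a::euclidean_space \<Rightarrow> ereal) \<Rightarrow> 'a measure \<Rightarrow> ereal" where
  "energy W \<rho> = interaction W \<rho> \<rho> / 2"

text \<open>\<open>F\<close> may take the value \<open>\<infinity>\<close>. Where \<open>F a\<close> and \<open>F b\<close> are finite, the strict inequality
  forces \<open>F\<close> to be finite between \<open>a\<close> and \<open>b\<close>.\<close>

definition strictly_convex_on :: "real set \<Rightarrow> (real \<Rightarrow> ereal) \<Rightarrow> bool" where
  "strictly_convex_on S F \<longleftrightarrow> convex S \<and>
     (\<forall>a\<in>S. \<forall>b\<in>S. \<forall>s. a \<noteq> b \<and> 0 < s \<and> s < 1 \<longrightarrow>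
        F ((1 - s) * a + s * b) < ereal (1 - s) * F a + ereal s * F b)"

definition LIC :: "('a::euclidean_space \<Rightarrow> ereal) \<Rightarrow> bool" where
  "LIC W \<longleftrightarrow>
     (\<forall>\<rho>0\<in>borel_prob2. \<forall>\<rho>1\<in>borel_prob2.
        \<rho>0 \<noteq> \<rho>1 \<and> center_of_mass \<rho>0 = center_of_mass \<rho>1 \<and>
        energy W \<rho>0 < \<infinity> \<and> energy W \<rho>1 < \<infinity> \<longrightarrow>
        strictly_convex_on {0..1} (\<lambda>t. energy W (mix_measure (1 - t) \<rho>0 t \<rho>1)))"

section \<open>Signed measures\<close>

text \<open>A finite signed Borel measure \<open>\<mu>\<close> is given by its Jordan decomposition
  \<open>\<mu> = \<mu>p - \<mu>n\<close>: two mutually singular finite Borel measures. Then \<open>\<bar>\<mu>\<bar> = \<mu>p + \<mu>n\<close>.\<close>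

definition jordan_pair :: "'a::euclidean_space measure \<Rightarrow> 'a measure \<Rightarrow> bool" where
  "jordan_pair \<mu>p \<mu>n \<longleftrightarrow>
     finite_measure \<mu>p \<and> sets \<mu>p = sets borel \<and>
     finite_measure \<mu>n \<and> sets \<mu>n = sets borel \<and>
     (\<exists>A\<in>sets borel. emeasure \<mu>p A = 0 \<and> emeasure \<mu>n (- A) = 0)"

definition total_variation_measure ::
    "'a::euclidean_space measure \<Rightarrow> 'a measure \<Rightarrow> 'a measure" where
  "total_variation_measure \<mu>p \<mu>n = mix_measure 1 \<mu>p 1 \<mu>n"

definition signed_energy ::
    "('a::euclidean_space \<Rightarrow> ereal) \<Rightarrow> 'a measure \<Rightarrow> 'a measure \<Rightarrow> ereal" where
  "signed_energy W \<mu>p \<mu>n =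
     (interaction W \<mu>p \<mu>p - interaction W \<mu>p \<mu>n - interaction W \<mu>n \<mu>p + interaction W \<mu>n \<mu>n) / 2"

definition signed_fourier ::
    "'a::euclidean_space measure \<Rightarrow> 'a measure \<Rightarrow> 'a \<Rightarrow> complex" where
  "signed_fourier \<mu>p \<mu>n \<xi> =
     (CLINT x|\<mu>p. exp (- \<i> * complex_of_real (x \<bullet> \<xi>))) -
     (CLINT x|\<mu>n. exp (- \<i> * complex_of_real (x \<bullet> \<xi>)))"

text \<open>Finite second moment, \<open>\<integral>d\<mu> = 0\<close>, \<open>\<integral>x d\<mu> = 0\<close> and \<open>E[\<bar>\<mu>\<bar>] < \<infinity>\<close>.\<close>

definition admissible_signed ::
    "('a::euclidean_space \<Rightarrow> ereal) \<Rightarrow> 'a measure \<Rightarrow> 'a measure \<Rightarrow> bool" where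
  "admissible_signed W \<mu>p \<mu>n \<longleftrightarrow> jordan_pair \<mu>p \<mu>n \<and>
     integrable (total_variation_measure \<mu>p \<mu>n) (\<lambda>x. (norm x)\<^sup>2) \<and>
     measure \<mu>p UNIV - measure \<mu>n UNIV = 0 \<and>
     (LINT x|\<mu>p. x) - (LINT x|\<mu>n. x) = 0 \<and>
     energy W (total_variation_measure \<mu>p \<mu>n) < \<infinity>"

definition FLIC :: "('a::euclidean_space \<Rightarrow> ereal) \<Rightarrow> bool" where
  "FLIC W \<longleftrightarrow>
     (\<forall>r R. 0 < r \<and> r < R \<longrightarrow>
        (\<exists>c>0. \<forall>\<mu>p \<mu>n. admissible_signed W \<mu>p \<mu>n \<longrightarrow>
           signed_energy W \<mu>p \<mu>n \<ge>
             ereal (c * (LINT \<xi>:{\<xi>. r \<le> norm \<xi> \<and> norm \<xi> \<le> R}|lborel.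
                           (cmod (signed_fourier \<mu>p \<mu>n \<xi>))\<^sup>2))))"

section \<open>Local minimizers\<close>

definition transport_plans ::
    "'a::euclidean_space measure \<Rightarrow> 'a measure \<Rightarrow> ('a \<times> 'a) measure set" where
  "transport_plans \<mu> \<nu> =
     {\<pi> \<in> borel_prob. distr \<pi> borel fst = \<mu> \<and> distr \<pi> borel snd = \<nu>}"

definition d_inf :: "'a::euclidean_space measure \<Rightarrow> 'a measure \<Rightarrow> ereal" where
  "d_inf \<mu> \<nu> = (INF \<pi>\<in>transport_plans \<mu> \<nu>. SUP p\<in>msupp \<pi>. ereal (norm (fst p - snd p)))"

definition d_inf_local_minimizer :: "('a::euclidean_space \<Rightarrow> ereal) \<Rightarrow> 'a measure \<Rightarrow> bool" where
  "d_inf_local_minimizer W \<rho> \<longleftrightarrow>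
     (\<exists>\<epsilon>>0. \<forall>\<nu>\<in>borel_prob. compactly_supported \<nu> \<and> d_inf \<rho> \<nu> < ereal \<epsilon> \<longrightarrow>
        energy W \<rho> \<le> energy W \<nu>)"

section \<open>Steady states\<close>

text \<open>The potential need not be convex, so the subdifferential is the Frechet one, which reduces to
  \<open>{\<nabla>V x}\<close> where \<open>V\<close> is differentiable.\<close>

definition subdifferential :: "('a::euclidean_space \<Rightarrow> ereal) \<Rightarrow> 'a \<Rightarrow> 'a set" where
  "subdifferential V x =
     {p. \<bar>V x\<bar> \<noteq> \<infinity> \<and>
         0 \<le> Liminf (at x) (\<lambda>y. (V y - V x - ereal (p \<bullet> (y - x))) / ereal (norm (y - x)))}"

definition steady_state :: "('a::euclidean_space \<Rightarrow> ereal) \<Rightarrow> 'a measure \<Rightarrow> bool" where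
  "steady_state W \<rho> \<longleftrightarrow> (AE x in \<rho>. 0 \<in> subdifferential (potential W \<rho>) x)"

text \<open>\<open>V\<close> is finite and twice differentiable everywhere, with gradient \<open>G\<close> and Hessian \<open>H\<close>, the
  Hessian at a point being the linear map \<open>h \<mapsto> DG h\<close>.\<close>

definition has_hessian ::
    "('a::euclidean_space \<Rightarrow> ereal) \<Rightarrow> ('a \<Rightarrow> 'a \<Rightarrow>\<^sub>L 'a) \<Rightarrow> bool" where
  "has_hessian V H \<longleftrightarrow>
     (\<exists>v G. (\<forall>x. V x = ereal (v x)) \<and>
            (\<forall>x. (v has_derivative (\<lambda>h. G x \<bullet> h)) (at x)) \<and>
            (\<forall>x. (G has_derivative blinfun_apply (H x)) (at x)))"

definition positive_semidefinite :: "('a::euclidean_space \<Rightarrow>\<^sub>L 'a) \<Rightarrow> bool" where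
  "positive_semidefinite A \<longleftrightarrow> (\<forall>h. 0 \<le> h \<bullet> blinfun_apply A h)"

end

theory Submission
  imports Defs
begin

text \<open>
  After subtracting a lower bound from \<open>W\<close>, the energy is, on probability
  measures and up to a constant, half the quadratic form \<open>J \<rho> \<rho>\<close> of a symmetric bilinear form
  \<open>J\<close> with values in \<open>[0, \<infinity>]\<close>, which is invariant under isometries because \<open>W\<close> is radial. Linear
  interpolation convexity, read at the midpoint of a segment, says that \<open>J\<close> is positive definite on
  differences of probability measures with the same center of mass:
  \<open>2 J \<mu> \<nu> < J \<mu> \<mu> + J \<nu> \<nu>\<close> for \<open>\<mu> \<noteq> \<nu>\<close> of finite energy and second moment (\<open>LIC_cross_energy\<close>).
  Write \<open>R\<^sub>t\<close> for the rotation of angle \<open>t\<close> in some plane about the center of mass of \<open>\<rho>\<close>, and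
  \<open>\<rho>\<^sub>t\<close> for the image of \<open>\<rho>\<close>. In both parts the claim is that \<open>\<rho>\<^sub>t = \<rho>\<close> for all \<open>t\<close>.

  For a local minimizer, \<open>\<rho>\<^sub>t\<close> has the same energy as \<open>\<rho>\<close>, and for small \<open>t\<close> the midpoint of \<open>\<rho>\<close>
  and \<open>\<rho>\<^sub>t\<close> is close to \<open>\<rho>\<close> in \<open>d\<^sub>\<infinity>\<close>. If \<open>\<rho>\<^sub>t \<noteq> \<rho>\<close>, strict convexity makes the energy of the
  midpoint smaller, a contradiction. This requires \<open>E[\<rho>] < \<infinity>\<close>, which holds since \<open>\<rho>\<close> has
  neighbours of finite energy, obtained by convolution with the uniform law on a small ball. Large
  angles are multiples of small ones.

  For a steady state, consider the defect \<open>g t = J \<rho> \<rho> - J \<rho> \<rho>\<^sub>t = - \<integral> (V (R\<^sub>t x) - V x) d\<rho> x\<close>, where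
  \<open>V = W * \<rho>\<close>. On the support of \<open>\<rho>\<close> the gradient of \<open>V\<close> vanishes and its Hessian is
  nonnegative, so Taylor expansion gives \<open>g t \<le> o(t\<^sup>2)\<close>. On the other hand, positivity of \<open>J\<close> on
  the second difference \<open>\<rho>\<^sub>t + \<rho>\<^sub>-\<^sub>t - 2 \<rho>\<close> gives \<open>g (2 t) \<le> 4 g t\<close> (\<open>defect_double\<close>). Iterating,
  \<open>g t \<le> 4\<^sup>n g (t / 2\<^sup>n)\<close> tends to at most \<open>0\<close>, and strict positivity forces \<open>\<rho>\<^sub>t = \<rho>\<close>. This is the
  triangle inequality for the Hilbert norm defined by \<open>J\<close>, restricted to halving the angle.

  Finally, invariance under all plane rotations implies invariance under all orthogonal maps, also
  those of determinant \<open>- 1\<close>: on each orbit of a circle of rotations a hyperplane reflection acts like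
  a rotation followed by reversal of the angle, which preserves averages over the circle, and
  reflections generate the orthogonal group (\<open>radial_about_of_plane_rotations\<close>).
\<close>

section \<open>Mixtures, supports and isometric images of Borel measures\<close>

lemma borel_probI: "prob_space \<rho> \<Longrightarrow> sets \<rho> = sets borel \<Longrightarrow> \<rho> \<in> borel_prob"
  by (simp add: borel_prob_def)

lemma borel_probD:
  assumes "\<rho> \<in> borel_prob"
  shows "prob_space \<rho>" "sets \<rho> = sets borel" "space \<rho> = UNIV"
  using assms sets_eq_imp_space_eq[of \<rho> borel] by (auto simp: borel_prob_def)

lemma space_mix_measure [simp]: "space (mix_measure a \<mu> b \<nu>) = UNIV"
  using sets_eq_imp_space_eq[of "mix_measure a \<mu> b \<nu>" borel] by simp

lemma borel_prob_mix:
  assumes "\<mu> \<in> borel_prob" "\<nu> \<in> borel_prob" "0 \<le> a" "0 \<le> b" "a + b = 1"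
  shows "mix_measure a \<mu> b \<nu> \<in> borel_prob"
proof (intro borel_probI prob_spaceI)
  note m = borel_probD[OF assms(1)] and n = borel_probD[OF assms(2)]
  have "emeasure \<mu> UNIV = 1" "emeasure \<nu> UNIV = 1"
    using prob_space.emeasure_space_1 m n by metis+
  then show "emeasure (mix_measure a \<mu> b \<nu>) (space (mix_measure a \<mu> b \<nu>)) = 1"
    using assms m n by (simp add: emeasure_mix_measure flip: ennreal_plus)
qed simp

lemma borel_prob_distr:
  assumes "\<mu> \<in> borel_prob" "T \<in> borel \<rightarrow>\<^sub>M borel"
  shows "distr \<mu> borel T \<in> borel_prob"
proof (rule borel_probI)
  note m = borel_probD[OF assms(1)]
  have "T \<in> \<mu> \<rightarrow>\<^sub>M borel" using assms(2) m by simp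
  then show "prob_space (distr \<mu> borel T)"
    by (rule prob_space.prob_space_distr[OF m(1)])
qed simp

lemma nn_integral_mix_measure:
  assumes s: "sets \<mu> = sets borel" "sets \<nu> = sets borel"
    and f: "f \<in> borel_measurable borel"
  shows "(\<integral>\<^sup>+x. f x \<partial>mix_measure a \<mu> b \<nu>) =
    ennreal a * (\<integral>\<^sup>+x. f x \<partial>\<mu>) + ennreal b * (\<integral>\<^sup>+x. f x \<partial>\<nu>)"
  using f
proof (induction rule: borel_measurable_induct)
  case (cong f g)
  then have "f = g" by auto
  with cong show ?case by simp
next
  case (set A)
  then show ?case using s by (simp add: emeasure_mix_measure)
next
  case (mult u c)
  then have "u \<in> borel_measurable \<mu>" "u \<in> borel_measurable \<nu>"
    "u \<in> borel_measurable (mix_measure a \<mu> b \<nu>)"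
    using s by (simp_all cong: measurable_cong_sets)
  then show ?case
    using mult by (simp add: nn_integral_cmult distrib_left mult.left_commute)
next
  case (add u v)
  then have "u \<in> borel_measurable \<mu>" "u \<in> borel_measurable \<nu>"
    "u \<in> borel_measurable (mix_measure a \<mu> b \<nu>)"
    "v \<in> borel_measurable \<mu>" "v \<in> borel_measurable \<nu>"
    "v \<in> borel_measurable (mix_measure a \<mu> b \<nu>)"
    using s by (simp_all cong: measurable_cong_sets)
  then show ?case
    using add by (simp add: nn_integral_add distrib_left add_ac)
next
  case (seq U)
  then have m: "U i \<in> borel_measurable \<mu>" "U i \<in> borel_measurable \<nu>"
    "U i \<in> borel_measurable (mix_measure a \<mu> b \<nu>)" for i
    using s by (simp_all cong: measurable_cong_sets)
  have inc: "incseq (\<lambda>i. \<integral>\<^sup>+x. U i x \<partial>M)" for M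
    using \<open>incseq U\<close> by (auto simp: incseq_def le_fun_def intro!: nn_integral_mono)
  have "(\<integral>\<^sup>+x. (SUP i. U i) x \<partial>mix_measure a \<mu> b \<nu>) = (SUP i. \<integral>\<^sup>+x. U i x \<partial>mix_measure a \<mu> b \<nu>)"
    using nn_integral_monotone_convergence_SUP[OF \<open>incseq U\<close> m(3)] by (simp add: SUP_apply image_comp)
  also have "\<dots> = (SUP i. ennreal a * (\<integral>\<^sup>+x. U i x \<partial>\<mu>) + ennreal b * (\<integral>\<^sup>+x. U i x \<partial>\<nu>))"
    using seq by simp
  also have "\<dots> = (SUP i. ennreal a * (\<integral>\<^sup>+x. U i x \<partial>\<mu>)) + (SUP i. ennreal b * (\<integral>\<^sup>+x. U i x \<partial>\<nu>))"
    using inc by (intro ennreal_SUP_add) (auto simp: incseq_def intro!: mult_left_mono)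
  also have "\<dots> = ennreal a * (SUP i. \<integral>\<^sup>+x. U i x \<partial>\<mu>) + ennreal b * (SUP i. \<integral>\<^sup>+x. U i x \<partial>\<nu>)"
    by (simp add: SUP_mult_left_ennreal)
  also have "(SUP i. \<integral>\<^sup>+x. U i x \<partial>\<mu>) = (\<integral>\<^sup>+x. (SUP i. U i) x \<partial>\<mu>)"
    using nn_integral_monotone_convergence_SUP[OF \<open>incseq U\<close> m(1)] by (simp add: SUP_apply image_comp)
  also have "(SUP i. \<integral>\<^sup>+x. U i x \<partial>\<nu>) = (\<integral>\<^sup>+x. (SUP i. U i) x \<partial>\<nu>)"
    using nn_integral_monotone_convergence_SUP[OF \<open>incseq U\<close> m(2)] by (simp add: SUP_apply image_comp)
  finally show ?case .
qed

text \<open>A set that is null for only one of the two measures need not be null for the mixture; the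
  intersection of a null set of each is.\<close>

lemma AE_mix_measure:
  assumes s: "sets \<mu> = sets borel" "sets \<nu> = sets borel"
    and "AE x in \<mu>. P x" "AE x in \<nu>. P x"
  shows "AE x in mix_measure a \<mu> b \<nu>. P x"
proof -
  have u: "space \<mu> = UNIV" "space \<nu> = UNIV"
    using s sets_eq_imp_space_eq[of _ borel] by auto
  obtain M where M: "{x \<in> space \<mu>. \<not> P x} \<subseteq> M" "emeasure \<mu> M = 0" "M \<in> sets \<mu>"
    using AE_E[OF assms(3)] by blast
  obtain N where N: "{x \<in> space \<nu>. \<not> P x} \<subseteq> N" "emeasure \<nu> N = 0" "N \<in> sets \<nu>"
    using AE_E[OF assms(4)] by blast
  have "emeasure \<mu> (M \<inter> N) = 0" "emeasure \<nu> (M \<inter> N) = 0"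
    by (rule emeasure_eq_0[of M]; use M N s in auto) (rule emeasure_eq_0[of N]; use M N s in auto)
  then have "emeasure (mix_measure a \<mu> b \<nu>) (M \<inter> N) = 0"
    using s M N by (simp add: emeasure_mix_measure)
  then show ?thesis
    using M N s u by (intro AE_I[of _ _ "M \<inter> N"]) auto
qed

lemma distr_mix_measure:
  assumes s: "sets \<mu> = sets borel" "sets \<nu> = sets borel" and T: "T \<in> borel \<rightarrow>\<^sub>M borel"
  shows "distr (mix_measure a \<mu> b \<nu>) borel T =
    mix_measure a (distr \<mu> borel T) b (distr \<nu> borel T)"
proof (rule measure_eqI)
  fix A assume "A \<in> sets (distr (mix_measure a \<mu> b \<nu>) borel T)"
  then have A: "A \<in> sets borel" by simp
  have "T \<in> \<mu> \<rightarrow>\<^sub>M borel" "T \<in> \<nu> \<rightarrow>\<^sub>M borel" "T \<in> mix_measure a \<mu> b \<nu> \<rightarrow>\<^sub>M borel"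
    using T s by (simp_all cong: measurable_cong_sets)
  moreover have "T -` A \<in> sets borel"
    using measurable_sets[OF T A] by simp
  moreover have "space \<mu> = UNIV" "space \<nu> = UNIV"
    using s sets_eq_imp_space_eq[of _ borel] by auto
  ultimately show "emeasure (distr (mix_measure a \<mu> b \<nu>) borel T) A =
      emeasure (mix_measure a (distr \<mu> borel T) b (distr \<nu> borel T)) A"
    using A s by (simp add: emeasure_distr emeasure_mix_measure)
qed simp

lemma mix_measure_one_zero:
  assumes "sets \<mu> = sets borel" "sets \<nu> = sets borel"
  shows "mix_measure 1 \<mu> 0 \<nu> = \<mu>" "mix_measure 0 \<nu> 1 \<mu> = \<mu>"
  using assms by (auto intro!: measure_eqI simp: emeasure_mix_measure)

lemma mix_measure_self:
  assumes "sets \<mu> = sets borel" "0 \<le> a" "0 \<le> b" "a + b = 1"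
  shows "mix_measure a \<mu> b \<mu> = \<mu>"
proof (rule measure_eqI)
  fix A assume "A \<in> sets (mix_measure a \<mu> b \<mu>)"
  then have "emeasure (mix_measure a \<mu> b \<mu>) A = (ennreal a + ennreal b) * emeasure \<mu> A"
    using assms by (simp add: emeasure_mix_measure distrib_right)
  also have "ennreal a + ennreal b = 1"
    using assms by (metis ennreal_1 ennreal_plus)
  finally show "emeasure (mix_measure a \<mu> b \<mu>) A = emeasure \<mu> A" by simp
qed (use assms in simp)

text \<open>The complement of the support is a union of null sets from a countable base.\<close>

lemma AE_in_msupp:
  fixes \<rho> :: "'a::second_countable_topology measure"
  assumes s: "sets \<rho> = sets borel"
  shows "AE x in \<rho>. x \<in> msupp \<rho>"
proof -
  obtain B :: "'a set set" where B: "countable B" "topological_basis B"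
    using ex_countable_basis by blast
  define N where "N = {b \<in> B. emeasure \<rho> b = 0}"
  have op: "open b" if "b \<in> N" for b
    using that B(2) by (auto simp: N_def topological_basis_open)
  have "(\<Union>b\<in>N. b) \<in> null_sets \<rho>"
    using B(1) op s by (intro null_sets_UN') (auto simp: N_def)
  moreover have "{x \<in> space \<rho>. x \<notin> msupp \<rho>} \<subseteq> (\<Union>b\<in>N. b)"
  proof safe
    fix x assume "x \<notin> msupp \<rho>"
    then obtain U where U: "open U" "x \<in> U" "emeasure \<rho> U = 0"
      by (auto simp: msupp_def not_less)
    then obtain b where b: "b \<in> B" "x \<in> b" "b \<subseteq> U"
      using topological_basisE[OF B(2)] by metis
    have "emeasure \<rho> b = 0"
      by (rule emeasure_eq_0[of U]) (use U b s in auto)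
    with b show "x \<in> (\<Union>b\<in>N. b)" by (auto simp: N_def)
  qed
  ultimately show ?thesis
    by (rule AE_I')
qed

lemma msupp_subset_closed:
  assumes s: "sets \<rho> = sets borel" and K: "closed K" "AE x in \<rho>. x \<in> K"
  shows "msupp \<rho> \<subseteq> K"
proof
  fix x assume x: "x \<in> msupp \<rho>"
  show "x \<in> K"
  proof (rule ccontr)
    assume "x \<notin> K"
    then have "emeasure \<rho> (- K) > 0"
      using x K(1) by (auto simp: msupp_def)
    moreover have "AE x in \<rho>. x \<notin> - K"
      using K(2) by simp
    then have "emeasure \<rho> (- K) = 0"
      using K(1) s by (subst (asm) AE_iff_measurable[of "-K"]) (auto simp: sets_eq_imp_space_eq[of \<rho> borel])
    ultimately show False by simp
  qed
qed

lemma closed_msupp: "closed (msupp \<rho>)"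
proof -
  have "- msupp \<rho> = \<Union>{U. open U \<and> \<not> emeasure \<rho> U > 0}"
    by (auto simp: msupp_def)
  then show ?thesis
    by (metis (no_types, lifting) closed_def mem_Collect_eq open_Union)
qed

lemma compactly_supported_iff_AE_bounded:
  fixes \<rho> :: "'a::euclidean_space measure"
  assumes s: "sets \<rho> = sets borel"
  shows "compactly_supported \<rho> \<longleftrightarrow> (\<exists>B. AE x in \<rho>. norm x \<le> B)"
proof
  assume "compactly_supported \<rho>"
  then obtain B where B: "\<And>x. x \<in> msupp \<rho> \<Longrightarrow> norm x \<le> B"
    unfolding compactly_supported_def by (meson bounded_iff compact_imp_bounded)
  show "\<exists>B. AE x in \<rho>. norm x \<le> B"
    using AE_in_msupp[OF s] by (intro exI[of _ B], elim eventually_mono) (rule B)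
next
  assume "\<exists>B. AE x in \<rho>. norm x \<le> B"
  then obtain B where "AE x in \<rho>. x \<in> cball 0 B" by auto
  then have "msupp \<rho> \<subseteq> cball 0 B"
    using s by (intro msupp_subset_closed) auto
  then have "bounded (msupp \<rho>)" by (rule bounded_subset[OF bounded_cball])
  then show "compactly_supported \<rho>"
    using closed_msupp by (auto simp: compactly_supported_def compact_eq_bounded_closed)
qed

lemma compactly_supportedE:
  fixes \<rho> :: "'a::euclidean_space measure"
  assumes "\<rho> \<in> borel_prob" "compactly_supported \<rho>"
  obtains B where "AE x in \<rho>. norm x \<le> B"
  using assms compactly_supported_iff_AE_bounded[of \<rho>] by (auto simp: borel_prob_def)

lemma borel_prob2_of_bounded:
  fixes \<rho> :: "'a::euclidean_space measure"
  assumes "\<rho> \<in> borel_prob" and B: "AE x in \<rho>. norm x \<le> B"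
  shows "\<rho> \<in> borel_prob2" "integrable \<rho> (\<lambda>x. x)"
proof -
  note r = borel_probD[OF assms(1)]
  interpret prob_space \<rho> by fact
  have [measurable_cong]: "sets \<rho> = sets borel" by fact
  have "AE x in \<rho>. norm ((norm x)\<^sup>2) \<le> B\<^sup>2"
    using B by eventually_elim (auto intro: power_mono)
  then have "integrable \<rho> (\<lambda>x. (norm x)\<^sup>2)"
    by (rule integrable_const_bound) measurable
  then show "\<rho> \<in> borel_prob2" using assms by (simp add: borel_prob2_def)
  show "integrable \<rho> (\<lambda>x. x)"
    using B by (rule integrable_const_bound) measurable
qed

text \<open>Linearity is checked on coordinates, where the integral is a difference of two nonnegative
  integrals, each additive in the measure.\<close>

lemma center_of_mass_mix:
  fixes \<mu> \<nu> :: "'a::euclidean_space measure"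
  assumes \<mu>: "\<mu> \<in> borel_prob" "integrable \<mu> (\<lambda>x. x)" and \<nu>: "\<nu> \<in> borel_prob" "integrable \<nu> (\<lambda>x. x)"
    and m: "integrable (mix_measure a \<mu> b \<nu>) (\<lambda>x. x)" and "0 \<le> a" "0 \<le> b"
  shows "center_of_mass (mix_measure a \<mu> b \<nu>) =
    a *\<^sub>R center_of_mass \<mu> + b *\<^sub>R center_of_mass \<nu>"
proof (rule euclidean_eqI)
  fix i :: 'a assume i: "i \<in> Basis"
  note mm = borel_probD[OF \<mu>(1)] and nn = borel_probD[OF \<nu>(1)]
  have *: "(LINT x|M. x) \<bullet> i = enn2real (\<integral>\<^sup>+x. ennreal (x \<bullet> i) \<partial>M) - enn2real (\<integral>\<^sup>+x. ennreal (- (x \<bullet> i)) \<partial>M)"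
    if "integrable M (\<lambda>x. x)" for M :: "'a measure"
    using real_lebesgue_integral_def[OF integrable_inner_left[OF that], of i]
    by (subst (asm) integral_inner_left[OF that])
  have fin: "(\<integral>\<^sup>+x. ennreal (x \<bullet> i) \<partial>M) \<noteq> \<infinity>" "(\<integral>\<^sup>+x. ennreal (- (x \<bullet> i)) \<partial>M) \<noteq> \<infinity>"
    if "integrable M (\<lambda>x. x)" for M :: "'a measure"
    using integrable_inner_left[OF that, of i] unfolding real_integrable_def by blast+
  have [measurable]: "(\<lambda>x. ennreal (x \<bullet> i)) \<in> borel_measurable borel"
    "(\<lambda>x. ennreal (- (x \<bullet> i))) \<in> borel_measurable borel" by measurable
  have lin: "enn2real (ennreal a * u + ennreal b * v) = a * enn2real u + b * enn2real v"
    if "u \<noteq> \<infinity>" "v \<noteq> \<infinity>" for u v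
    using that \<open>0 \<le> a\<close> \<open>0 \<le> b\<close>
    by (cases u; cases v) (auto simp flip: ennreal_mult ennreal_plus)
  have "center_of_mass (mix_measure a \<mu> b \<nu>) \<bullet> i =
      enn2real (ennreal a * (\<integral>\<^sup>+x. ennreal (x \<bullet> i) \<partial>\<mu>) + ennreal b * (\<integral>\<^sup>+x. ennreal (x \<bullet> i) \<partial>\<nu>)) -
      enn2real (ennreal a * (\<integral>\<^sup>+x. ennreal (- (x \<bullet> i)) \<partial>\<mu>) + ennreal b * (\<integral>\<^sup>+x. ennreal (- (x \<bullet> i)) \<partial>\<nu>))"
    unfolding center_of_mass_def *[OF m] using mm(2) nn(2) by (simp add: nn_integral_mix_measure)
  also have "\<dots> = (a *\<^sub>R center_of_mass \<mu> + b *\<^sub>R center_of_mass \<nu>) \<bullet> i"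
    unfolding lin[OF fin(1)[OF \<mu>(2)] fin(1)[OF \<nu>(2)]] lin[OF fin(2)[OF \<mu>(2)] fin(2)[OF \<nu>(2)]]
      center_of_mass_def inner_add_left inner_scaleR_left *[OF \<mu>(2)] *[OF \<nu>(2)]
    by (simp add: algebra_simps)
  finally show "center_of_mass (mix_measure a \<mu> b \<nu>) \<bullet> i =
      (a *\<^sub>R center_of_mass \<mu> + b *\<^sub>R center_of_mass \<nu>) \<bullet> i" .
qed

section \<open>The energy as a symmetric bilinear form\<close>

text \<open>For \<open>b \<le> 0\<close> the negative part of \<open>f\<close> is at most \<open>- b\<close>, hence of finite integral, and
  \<open>(f - b) + f\<^sup>- = f\<^sup>+ + (- b)\<close> is an identity between nonnegative functions.\<close>

lemma ext_integral_shift: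
  assumes M: "prob_space M" and f: "f \<in> borel_measurable M"
    and b: "b \<le> 0" "\<And>x. ereal b \<le> f x"
  shows "ext_integral M f = enn2ereal (\<integral>\<^sup>+x. e2ennreal (f x - ereal b) \<partial>M) + ereal b"
proof -
  interpret prob_space M by fact
  have [measurable]: "f \<in> borel_measurable M" by fact
  define P where "P = (\<integral>\<^sup>+x. e2ennreal (f x) \<partial>M)"
  define N where "N = (\<integral>\<^sup>+x. e2ennreal (- f x) \<partial>M)"
  define G where "G = (\<integral>\<^sup>+x. e2ennreal (f x - ereal b) \<partial>M)"
  have pt: "e2ennreal (f x - ereal b) + e2ennreal (- f x) = e2ennreal (f x) + ennreal (- b)" for x
  proof (cases "f x")
    case (real r)
    show ?thesis
    proof (cases "r \<ge> 0")
      case True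
      then show ?thesis using b(1) real
        by (simp add: ennreal_neg flip: ennreal_plus)
    next
      case False
      then show ?thesis using b(1) b(2)[of x] real
        by (simp add: ennreal_neg flip: ennreal_plus)
    qed
  qed (use b(2)[of x] in \<open>auto simp: e2ennreal_neg\<close>)
  have "G + N = (\<integral>\<^sup>+x. e2ennreal (f x - ereal b) + e2ennreal (- f x) \<partial>M)"
    unfolding G_def N_def by (subst nn_integral_add) auto
  also have "\<dots> = P + ennreal (- b)"
    unfolding pt P_def by (subst nn_integral_add) (auto simp: emeasure_space_1)
  finally have eq: "G + N = P + ennreal (- b)" .
  have "N \<le> (\<integral>\<^sup>+x. ennreal (- b) \<partial>M)"
    unfolding N_def
  proof (intro nn_integral_mono)
    fix x show "e2ennreal (- f x) \<le> ennreal (- b)"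
      using e2ennreal_mono[of "- f x" "- ereal b"] b(2)[of x]
      by (metis e2ennreal_ereal ereal_minus_le_minus uminus_ereal.simps(1))
  qed
  then have "N < \<infinity>" by (simp add: emeasure_space_1 le_less_trans)
  then obtain n where n: "0 \<le> n" "N = ennreal n" by (cases N) auto
  have "enn2ereal P - enn2ereal N = enn2ereal G + ereal b"
  proof (cases P)
    case (real p)
    then obtain g where "0 \<le> g" "G = ennreal g"
      using eq n by (cases G) (auto simp flip: ennreal_plus simp add: ennreal_add_eq_top dest: sym)
    then show ?thesis using real n eq b(1) by (simp flip: ennreal_plus)
  next
    case top
    then have "G = top" using eq n by (cases G) (auto simp flip: ennreal_plus)
    then show ?thesis using top n by simp
  qed
  then show ?thesis by (simp add: ext_integral_def P_def N_def G_def)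
qed

text \<open>The normalisation \<open>b \<le> 0\<close> costs nothing, as a lower bound can be decreased.\<close>

locale radial_kernel =
  fixes W :: "'a::euclidean_space \<Rightarrow> ereal" and b :: real
  assumes W_measurable [measurable]: "W \<in> borel_measurable borel"
    and b_nonpos: "b \<le> 0" and W_lower: "\<And>x. ereal b \<le> W x"
    and W_radial: "radial_fun W"
begin

text \<open>Shifting by \<open>b\<close> makes the kernel nonnegative, so that the double integrals below need no
  integrability and Tonelli's theorem applies to them.\<close>

definition kernel :: "'a \<Rightarrow> ennreal" where "kernel x = e2ennreal (W x - ereal b)"

definition shifted_potential :: "'a measure \<Rightarrow> 'a \<Rightarrow> ennreal" where
  "shifted_potential \<nu> x = (\<integral>\<^sup>+y. kernel (x - y) \<partial>\<nu>)"

definition cross_energy :: "'a measure \<Rightarrow> 'a measure \<Rightarrow> ennreal" where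
  "cross_energy \<mu> \<nu> = (\<integral>\<^sup>+x. shifted_potential \<nu> x \<partial>\<mu>)"

lemma kernel_measurable [measurable]: "kernel \<in> borel_measurable borel"
  unfolding kernel_def by measurable

lemma kernel_radial: "norm x = norm y \<Longrightarrow> kernel x = kernel y"
  using W_radial[unfolded radial_fun_def, rule_format, of x y] by (simp add: kernel_def)

lemma shifted_potential_measurable [measurable]:
  assumes "\<nu> \<in> borel_prob"
  shows "shifted_potential \<nu> \<in> borel_measurable borel"
proof -
  note n = borel_probD[OF assms]
  interpret prob_space \<nu> by fact
  have [measurable_cong]: "sets \<nu> = sets borel" by fact
  show ?thesis unfolding shifted_potential_def by measurable
qed

lemma potential_eq:
  assumes "\<nu> \<in> borel_prob"
  shows "potential W \<nu> x = enn2ereal (shifted_potential \<nu> x) + ereal b"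
proof -
  note n = borel_probD[OF assms]
  have [measurable_cong]: "sets \<nu> = sets borel" by fact
  have "(\<lambda>y. W (x - y)) \<in> borel_measurable \<nu>" by measurable
  from ext_integral_shift[OF n(1) this b_nonpos W_lower] show ?thesis
    by (simp add: potential_def shifted_potential_def kernel_def)
qed

lemma interaction_eq:
  assumes \<mu>: "\<mu> \<in> borel_prob" and \<nu>: "\<nu> \<in> borel_prob"
  shows "interaction W \<mu> \<nu> = enn2ereal (cross_energy \<mu> \<nu>) + ereal b"
proof -
  note m = borel_probD[OF \<mu>]
  have [measurable_cong]: "sets \<mu> = sets borel" by fact
  have [measurable]: "shifted_potential \<nu> \<in> borel_measurable borel"
    using \<nu> by (rule shifted_potential_measurable)
  have "(\<lambda>x. enn2ereal (shifted_potential \<nu> x) + ereal b) \<in> borel_measurable \<mu>" by measurable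
  moreover have "ereal b \<le> enn2ereal (shifted_potential \<nu> x) + ereal b" for x
    using add_right_mono[OF enn2ereal_nonneg, of "ereal b"] by simp
  moreover have "enn2ereal z + ereal b - ereal b = enn2ereal z" for z
    by (cases z) auto
  ultimately show ?thesis
    using ext_integral_shift[OF m(1) _ b_nonpos, of "potential W \<nu>"]
    by (simp add: interaction_def potential_eq[OF \<nu>, abs_def] cross_energy_def)
qed

lemma energy_eq:
  assumes "\<mu> \<in> borel_prob"
  shows "energy W \<mu> = (enn2ereal (cross_energy \<mu> \<mu>) + ereal b) / 2"
  using assms by (simp add: energy_def interaction_eq)

lemma energy_eq_real:
  assumes "\<mu> \<in> borel_prob" "0 \<le> A" "cross_energy \<mu> \<mu> = ennreal A"
  shows "energy W \<mu> = ereal ((A + b) / 2)"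
proof -
  have "(ereal (A + b)) / 2 = ereal ((A + b) / 2)"
    by (metis ereal_divide numeral_eq_ereal zero_neq_numeral)
  then show ?thesis using assms by (simp add: energy_eq)
qed

lemma energy_finite_iff:
  assumes "\<mu> \<in> borel_prob"
  shows "energy W \<mu> < \<infinity> \<longleftrightarrow> cross_energy \<mu> \<mu> < \<infinity>"
  unfolding energy_eq[OF assms] by (cases "cross_energy \<mu> \<mu>") auto

lemma cross_energy_commute:
  assumes \<mu>: "\<mu> \<in> borel_prob" and \<nu>: "\<nu> \<in> borel_prob"
  shows "cross_energy \<mu> \<nu> = cross_energy \<nu> \<mu>"
proof -
  note m = borel_probD[OF \<mu>] and n = borel_probD[OF \<nu>]
  interpret M: prob_space \<mu> by fact
  interpret N: prob_space \<nu> by fact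
  interpret pair_sigma_finite \<mu> \<nu> ..
  have [measurable_cong]: "sets \<mu> = sets borel" "sets \<nu> = sets borel" by fact+
  have "cross_energy \<mu> \<nu> = (\<integral>\<^sup>+y. \<integral>\<^sup>+x. kernel (x - y) \<partial>\<mu> \<partial>\<nu>)"
    unfolding cross_energy_def shifted_potential_def by (intro Fubini'[symmetric]) measurable
  also have "\<dots> = cross_energy \<nu> \<mu>"
    unfolding cross_energy_def shifted_potential_def
    by (intro nn_integral_cong kernel_radial norm_minus_commute)
  finally show ?thesis .
qed

lemma cross_energy_mix_right:
  assumes "\<mu> \<in> borel_prob" "\<nu>1 \<in> borel_prob" "\<nu>2 \<in> borel_prob"
  shows "cross_energy \<mu> (mix_measure s \<nu>1 t \<nu>2) =
    ennreal s * cross_energy \<mu> \<nu>1 + ennreal t * cross_energy \<mu> \<nu>2"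
proof -
  note m = borel_probD[OF assms(1)] and n1 = borel_probD[OF assms(2)] and n2 = borel_probD[OF assms(3)]
  have [measurable_cong]: "sets \<mu> = sets borel" by fact
  note [measurable] = shifted_potential_measurable[OF assms(2)] shifted_potential_measurable[OF assms(3)]
  have "shifted_potential (mix_measure s \<nu>1 t \<nu>2) x =
      ennreal s * shifted_potential \<nu>1 x + ennreal t * shifted_potential \<nu>2 x" for x
    unfolding shifted_potential_def using n1 n2 by (intro nn_integral_mix_measure) auto
  then show ?thesis
    unfolding cross_energy_def by (simp add: nn_integral_add nn_integral_cmult cong: nn_integral_cong)
qed

lemma cross_energy_isometry:
  assumes \<mu>: "\<mu> \<in> borel_prob" and \<nu>: "\<nu> \<in> borel_prob"
    and T[measurable]: "T \<in> borel \<rightarrow>\<^sub>M borel" and iso: "\<And>x y. norm (T x - T y) = norm (x - y)"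
  shows "cross_energy (distr \<mu> borel T) (distr \<nu> borel T) = cross_energy \<mu> \<nu>"
proof -
  note m = borel_probD[OF \<mu>] and n = borel_probD[OF \<nu>]
  have [measurable_cong]: "sets \<mu> = sets borel" "sets \<nu> = sets borel" by fact+
  note [measurable] = shifted_potential_measurable[OF borel_prob_distr[OF \<nu> T]]
  have "shifted_potential (distr \<nu> borel T) (T x) = shifted_potential \<nu> x" for x
    unfolding shifted_potential_def
    by (subst nn_integral_distr) (auto intro!: nn_integral_cong kernel_radial iso)
  then show ?thesis
    unfolding cross_energy_def by (simp add: nn_integral_distr)
qed

lemma energy_isometry:
  assumes \<mu>: "\<mu> \<in> borel_prob"
    and T: "T \<in> borel \<rightarrow>\<^sub>M borel" "\<And>x y. norm (T x - T y) = norm (x - y)"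
  shows "energy W (distr \<mu> borel T) = energy W \<mu>"
  using assms by (simp add: energy_eq borel_prob_distr cross_energy_isometry)

end

lemma LIC_midpoint:
  assumes "LIC W" "\<mu> \<in> borel_prob2" "\<nu> \<in> borel_prob2" "\<mu> \<noteq> \<nu>"
    "center_of_mass \<mu> = center_of_mass \<nu>" "energy W \<mu> < \<infinity>" "energy W \<nu> < \<infinity>"
  shows "energy W (mix_measure (1/2) \<mu> (1/2) \<nu>) < ereal (1/2) * energy W \<mu> + ereal (1/2) * energy W \<nu>"
proof -
  have s: "sets \<mu> = sets borel" "sets \<nu> = sets borel"
    using assms by (auto simp: borel_prob2_def borel_prob_def)
  let ?F = "\<lambda>t. energy W (mix_measure (1 - t) \<mu> t \<nu>)"
  have "strictly_convex_on {0..1} ?F"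
    using assms unfolding LIC_def by blast
  then have "\<And>a b s. a \<in> {0..1} \<Longrightarrow> b \<in> {0..1} \<Longrightarrow> a \<noteq> b \<and> 0 < s \<and> s < 1 \<Longrightarrow>
      ?F ((1 - s) * a + s * b) < ereal (1 - s) * ?F a + ereal s * ?F b"
    unfolding strictly_convex_on_def by blast
  from this[of 0 1 "1/2"]
  have "?F (1/2) < ereal (1/2) * ?F 0 + ereal (1/2) * ?F 1" by simp
  then show ?thesis
    using mix_measure_one_zero(1)[OF s] mix_measure_one_zero(2)[OF s(2) s(1)] by simp
qed

context radial_kernel
begin

text \<open>Expanding the energy of the midpoint turns linear interpolation convexity into
  positivity of the quadratic form on \<open>\<mu> - \<nu>\<close>.\<close>

lemma LIC_cross_energy:
  assumes LIC: "LIC W" and "\<mu> \<in> borel_prob2" "\<nu> \<in> borel_prob2" "\<mu> \<noteq> \<nu>"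
    "center_of_mass \<mu> = center_of_mass \<nu>" "cross_energy \<mu> \<mu> < \<infinity>" "cross_energy \<nu> \<nu> < \<infinity>"
  shows "2 * cross_energy \<mu> \<nu> < cross_energy \<mu> \<mu> + cross_energy \<nu> \<nu>"
proof -
  have p: "\<mu> \<in> borel_prob" "\<nu> \<in> borel_prob" using assms by (auto simp: borel_prob2_def)
  let ?m = "mix_measure (1/2) \<mu> (1/2) \<nu>"
  have pm: "?m \<in> borel_prob" using p by (intro borel_prob_mix) auto
  obtain A where A: "0 \<le> A" "cross_energy \<mu> \<mu> = ennreal A" using assms(6) by (cases "cross_energy \<mu> \<mu>") auto
  obtain B where B: "0 \<le> B" "cross_energy \<nu> \<nu> = ennreal B" using assms(7) by (cases "cross_energy \<nu> \<nu>") auto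
  have lt: "energy W ?m < ereal (1/2) * energy W \<mu> + ereal (1/2) * energy W \<nu>"
    by (rule LIC_midpoint[OF assms(1-5)]) (simp_all only: energy_finite_iff p assms(6,7))
  have m: "cross_energy ?m ?m = ennreal (1/2) * (ennreal (1/2) * cross_energy \<mu> \<mu> + ennreal (1/2) * cross_energy \<mu> \<nu>)
     + ennreal (1/2) * (ennreal (1/2) * cross_energy \<mu> \<nu> + ennreal (1/2) * cross_energy \<nu> \<nu>)"
    unfolding cross_energy_mix_right[OF pm p] cross_energy_commute[OF pm p(1)]
      cross_energy_commute[OF pm p(2)] cross_energy_mix_right[OF p(1) p]
      cross_energy_mix_right[OF p(2) p] cross_energy_commute[OF p(2) p(1)] ..
  show ?thesis
  proof (cases "cross_energy \<mu> \<nu>")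
    case (real C)
    \<comment> \<open>Both \<open>m\<close> and this identity keep the factors \<open>ennreal (1/2)\<close> unsimplified: as numerals in
      \<open>ennreal\<close> they would turn into inverses, which do not combine with real coefficients.\<close>
    have half: "ennreal (1/2) * (ennreal (1/2) * ennreal x + ennreal (1/2) * ennreal y) =
        ennreal (1/2 * (1/2 * x + 1/2 * y))" if "0 \<le> x" "0 \<le> y" for x y
    proof -
      have "(0::real) \<le> 1/2" by simp
      then show ?thesis
        using that by (simp only: ennreal_mult ennreal_plus mult_nonneg_nonneg add_nonneg_nonneg)
    qed
    have "cross_energy ?m ?m =
        ennreal (1/2 * (1/2 * A + 1/2 * C)) + ennreal (1/2 * (1/2 * C + 1/2 * B))"
      unfolding m A(2) B(2) real(2) using A(1) B(1) real(1) by (simp only: half)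
    also have "\<dots> = ennreal (1/2 * (1/2 * A + 1/2 * C) + 1/2 * (1/2 * C + 1/2 * B))"
      using A(1) B(1) real(1) by (intro ennreal_plus[symmetric]) auto
    finally have "energy W ?m = ereal ((1/2 * (1/2 * A + 1/2 * C) + 1/2 * (1/2 * C + 1/2 * B) + b) / 2)"
      using A(1) B(1) real(1) by (intro energy_eq_real[OF pm]) auto
    then have "(1/2 * (1/2 * A + 1/2 * C) + 1/2 * (1/2 * C + 1/2 * B) + b) / 2
        < (1/2) * ((A + b)/2) + (1/2) * ((B + b)/2)"
      using lt unfolding energy_eq_real[OF p(1) A] energy_eq_real[OF p(2) B] by simp
    then have "2 * C < A + B" by (simp add: field_simps)
    then have "ennreal (2 * C) < ennreal (A + B)"
      using real(1) by (intro ennreal_lessI) auto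
    then show ?thesis
      using A B real by (simp add: ennreal_mult)
  next
    case top
    then have "cross_energy ?m ?m = \<infinity>" unfolding m
      by (simp add: ennreal_mult_top ennreal_mult_eq_top_iff)
    then have "energy W ?m = \<infinity>"
      using energy_finite_iff[OF pm] by simp
    then show ?thesis using lt by simp
  qed
qed

lemma LIC_cross_energy_le:
  assumes "LIC W" and "\<mu> \<in> borel_prob2" "\<nu> \<in> borel_prob2"
    "center_of_mass \<mu> = center_of_mass \<nu>" "cross_energy \<mu> \<mu> < \<infinity>" "cross_energy \<nu> \<nu> < \<infinity>"
  shows "2 * cross_energy \<mu> \<nu> \<le> cross_energy \<mu> \<mu> + cross_energy \<nu> \<nu>"
proof (cases "\<mu> = \<nu>")
  case True
  then show ?thesis by (simp add: mult_2)
next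
  case False
  then show ?thesis by (rule less_imp_le[OF LIC_cross_energy[OF assms(1-3) _ assms(4-6)]])
qed

end

section \<open>Plane rotations, reflections and radial symmetry\<close>

text \<open>For orthonormal \<open>a\<close> and \<open>b\<close>, the rotation in their plane that fixes the orthogonal complement;
  written as a perturbation of \<open>x\<close>, it needs no basis of that complement.\<close>

definition plane_rotation :: "'a::euclidean_space \<Rightarrow> 'a \<Rightarrow> real \<Rightarrow> 'a \<Rightarrow> 'a" where
  "plane_rotation a b t x = x
     + ((cos t - 1) * (x \<bullet> a) - sin t * (x \<bullet> b)) *\<^sub>R a
     + (sin t * (x \<bullet> a) + (cos t - 1) * (x \<bullet> b)) *\<^sub>R b"

text \<open>For a unit vector \<open>a\<close>, the reflection in the hyperplane orthogonal to \<open>a\<close>.\<close>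

definition reflection :: "'a::euclidean_space \<Rightarrow> 'a \<Rightarrow> 'a" where
  "reflection a x = x - (2 * (x \<bullet> a)) *\<^sub>R a"

definition orthonormal_pair :: "'a::euclidean_space \<Rightarrow> 'a \<Rightarrow> bool" where
  "orthonormal_pair a b \<longleftrightarrow> a \<bullet> a = 1 \<and> b \<bullet> b = 1 \<and> a \<bullet> b = 0"

text \<open>The affine map with linear part \<open>f\<close> and fixed point \<open>c\<close>.\<close>

definition about :: "'a::euclidean_space \<Rightarrow> ('a \<Rightarrow> 'a) \<Rightarrow> 'a \<Rightarrow> 'a" where
  "about c f x = c + f (x - c)"

lemma about_comp: "about c f (about c g x) = about c (f \<circ> g) x"
  by (simp add: about_def)

lemma plane_rotation_coords:
  assumes "orthonormal_pair a b"
  shows "plane_rotation a b t x \<bullet> a = cos t * (x \<bullet> a) - sin t * (x \<bullet> b)"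
    and "plane_rotation a b t x \<bullet> b = sin t * (x \<bullet> a) + cos t * (x \<bullet> b)"
  using assms
  by (simp_all add: plane_rotation_def orthonormal_pair_def inner_add_left inner_commute[of b a] algebra_simps)

lemma plane_rotation_add:
  assumes "orthonormal_pair a b"
  shows "plane_rotation a b s (plane_rotation a b t x) = plane_rotation a b (s + t) x"
proof -
  have eqs: "((cos s - 1) * (cos t * (x \<bullet> a) - sin t * (x \<bullet> b)) - sin s * (sin t * (x \<bullet> a) + cos t * (x \<bullet> b)))
      + ((cos t - 1) * (x \<bullet> a) - sin t * (x \<bullet> b))
      = (cos (s + t) - 1) * (x \<bullet> a) - sin (s + t) * (x \<bullet> b)"
    and eqs2: "(sin s * (cos t * (x \<bullet> a) - sin t * (x \<bullet> b)) + (cos s - 1) * (sin t * (x \<bullet> a) + cos t * (x \<bullet> b)))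
      + (sin t * (x \<bullet> a) + (cos t - 1) * (x \<bullet> b))
      = sin (s + t) * (x \<bullet> a) + (cos (s + t) - 1) * (x \<bullet> b)"
    by (simp_all add: cos_add sin_add algebra_simps)
  have collect: "x + p *\<^sub>R a + q *\<^sub>R b + p' *\<^sub>R a + q' *\<^sub>R b = x + (p' + p) *\<^sub>R a + (q' + q) *\<^sub>R b"
    for p q p' q' :: real
    by (simp add: scaleR_add_left)
  show ?thesis
    unfolding plane_rotation_def[of a b s] plane_rotation_coords[OF assms]
    unfolding plane_rotation_def collect eqs eqs2 ..
qed

lemma plane_rotation_zero: "plane_rotation a b 0 x = x"
  by (simp add: plane_rotation_def)

lemma orthogonal_plane_rotation:
  assumes "orthonormal_pair a b"
  shows "orthogonal_transformation (plane_rotation a b t)"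
  unfolding orthogonal_transformation
proof (intro conjI allI)
  show "linear (plane_rotation a b t)"
    by (rule linearI) (simp_all add: plane_rotation_def inner_add_left algebra_simps)
  fix x
  define p where "p = (cos t - 1) * (x \<bullet> a) - sin t * (x \<bullet> b)"
  define q where "q = sin t * (x \<bullet> a) + (cos t - 1) * (x \<bullet> b)"
  have sc: "sin t * sin t = 1 - cos t * cos t"
    using sin_cos_squared_add[of t] by (simp add: power2_eq_square)
  have expand: "(x + p *\<^sub>R a + q *\<^sub>R b) \<bullet> (x + p *\<^sub>R a + q *\<^sub>R b) =
      x \<bullet> x + (2 * p * (x \<bullet> a) + 2 * q * (x \<bullet> b) + p * p + q * q)" for p q
    using assms
    by (simp add: orthonormal_pair_def inner_add_left inner_add_right
        inner_commute[of b a] inner_commute[of a x] inner_commute[of b x] algebra_simps)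
  have "2 * p * (x \<bullet> a) + 2 * q * (x \<bullet> b) + p * p + q * q =
     (sin t * sin t) * (x \<bullet> a * (x \<bullet> a) + x \<bullet> b * (x \<bullet> b)) +
     (cos t * cos t) * (x \<bullet> a * (x \<bullet> a) + x \<bullet> b * (x \<bullet> b)) - (x \<bullet> a * (x \<bullet> a) + x \<bullet> b * (x \<bullet> b))"
    by (simp add: p_def q_def algebra_simps)
  then have "2 * p * (x \<bullet> a) + 2 * q * (x \<bullet> b) + p * p + q * q = 0"
    unfolding sc by (simp add: algebra_simps)
  then have "plane_rotation a b t x \<bullet> plane_rotation a b t x = x \<bullet> x"
    unfolding plane_rotation_def p_def[symmetric] q_def[symmetric] expand by simp
  then show "norm (plane_rotation a b t x) = norm x"
    by (simp add: norm_eq)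
qed

lemma plane_rotation_displacement:
  assumes "orthonormal_pair a b"
  shows "norm (plane_rotation a b t x - x) \<le> 4 * \<bar>t\<bar> * norm x"
proof -
  have n: "norm a = 1" "norm b = 1"
    using assms by (simp_all add: orthonormal_pair_def norm_eq_1)
  have xa: "\<bar>x \<bullet> a\<bar> \<le> norm x" "\<bar>x \<bullet> b\<bar> \<le> norm x"
    using Cauchy_Schwarz_ineq2[of x a] Cauchy_Schwarz_ineq2[of x b] n by auto
  have s: "\<bar>sin t\<bar> \<le> \<bar>t\<bar>" by (rule abs_sin_x_le_abs_x)
  have "\<bar>cos t - cos 0\<bar> \<le> \<bar>t - 0\<bar>"
  proof -
    have "cos t - cos 0 = - 2 * (sin (t/2) * sin (t/2))"
      using cos_double_sin[of "t/2"] by (simp add: power2_eq_square)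
    then have "\<bar>cos t - cos 0\<bar> = 2 * (\<bar>sin (t/2)\<bar> * \<bar>sin (t/2)\<bar>)"
      by (simp add: abs_mult)
    also have "\<dots> \<le> 2 * (\<bar>t/2\<bar> * 1)"
      using abs_sin_x_le_abs_x[of "t/2"] abs_sin_le_one[of "t/2"]
      by (intro mult_left_mono mult_mono) auto
    finally show ?thesis by simp
  qed
  then have c: "\<bar>cos t - 1\<bar> \<le> \<bar>t\<bar>" by simp
  have m: "\<bar>u * v\<bar> \<le> \<bar>t\<bar> * norm x" if "\<bar>u\<bar> \<le> \<bar>t\<bar>" "\<bar>v\<bar> \<le> norm x" for u v :: real
    unfolding abs_mult using that by (intro mult_mono) auto
  have "norm (plane_rotation a b t x - x) \<le>
      norm (((cos t - 1) * (x \<bullet> a) - sin t * (x \<bullet> b)) *\<^sub>R a)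
      + norm ((sin t * (x \<bullet> a) + (cos t - 1) * (x \<bullet> b)) *\<^sub>R b)"
    unfolding plane_rotation_def by (metis (no_types, lifting) add.assoc add_diff_cancel_left' norm_triangle_ineq)
  also have "\<dots> \<le> 2 * (\<bar>t\<bar> * norm x) + 2 * (\<bar>t\<bar> * norm x)"
    using m[OF c xa(1)] m[OF c xa(2)] m[OF s xa(1)] m[OF s xa(2)] n by simp arith
  finally show ?thesis by simp
qed

text \<open>In polar coordinates of the plane spanned by \<open>a\<close> and \<open>b\<close>, the reflection sends the angle
  \<open>\<tau>\<close> to \<open>\<pi> - \<tau>\<close>; a point at angle \<open>\<tau>\<close> is thus moved like by a rotation of angle \<open>\<pi> - 2 \<tau>\<close>.\<close>

lemma reflection_of_rotated_point:
  assumes ab: "orthonormal_pair a b"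
  obtains \<phi> where "0 \<le> \<phi>" "\<phi> < 2 * pi"
    "\<And>t. reflection a (plane_rotation a b t x) = plane_rotation a b (\<phi> - t) x"
proof -
  obtain r \<tau> where r: "x \<bullet> a = r * cos \<tau>" "x \<bullet> b = r * sin \<tau>"
    using polar_Ex by blast
  obtain \<phi> where \<phi>: "0 \<le> \<phi>" "\<phi> < 2 * pi" "cos (pi - 2 * \<tau>) = cos \<phi>" "sin (pi - 2 * \<tau>) = sin \<phi>"
    using sincos_total_2pi[of "cos (pi - 2 * \<tau>)" "sin (pi - 2 * \<tau>)"] by (auto simp: add.commute)
  have "reflection a (plane_rotation a b t x) = plane_rotation a b (\<phi> - t) x" for t
  proof -
    have ang: "cos (\<phi> - t) * cos \<tau> - sin (\<phi> - t) * sin \<tau> = - cos (t + \<tau>)"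
      "sin (\<phi> - t) * cos \<tau> + cos (\<phi> - t) * sin \<tau> = sin (t + \<tau>)"
    proof -
      have "cos (\<phi> - t) = cos (pi - 2 * \<tau> - t)" "sin (\<phi> - t) = sin (pi - 2 * \<tau> - t)"
        using \<phi> by (simp_all only: cos_diff sin_diff)
      moreover have "cos (pi - 2 * \<tau> - t + \<tau>) = - cos (t + \<tau>)" "sin (pi - 2 * \<tau> - t + \<tau>) = sin (t + \<tau>)"
        using cos_minus_pi[of "t + \<tau>"] cos_pi_minus[of "t + \<tau>"] sin_pi_minus[of "t + \<tau>"]
        by (simp_all add: algebra_simps)
      ultimately show "cos (\<phi> - t) * cos \<tau> - sin (\<phi> - t) * sin \<tau> = - cos (t + \<tau>)"
        "sin (\<phi> - t) * cos \<tau> + cos (\<phi> - t) * sin \<tau> = sin (t + \<tau>)"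
        by (simp_all only: cos_add[symmetric] sin_add[symmetric])
    qed
    have ca: "(cos (\<phi> - t) - 1) * (x \<bullet> a) - sin (\<phi> - t) * (x \<bullet> b)
        = (cos t - 1) * (x \<bullet> a) - sin t * (x \<bullet> b) - 2 * (cos t * (x \<bullet> a) - sin t * (x \<bullet> b))"
    proof -
      have "(cos (\<phi> - t) - 1) * (x \<bullet> a) - sin (\<phi> - t) * (x \<bullet> b)
        = r * (cos (\<phi> - t) * cos \<tau> - sin (\<phi> - t) * sin \<tau>) - x \<bullet> a"
        by (simp add: r algebra_simps)
      also have "\<dots> = - r * cos (t + \<tau>) - x \<bullet> a" unfolding ang by simp
      finally show ?thesis by (simp add: r cos_add algebra_simps)
    qed
    have cb: "sin (\<phi> - t) * (x \<bullet> a) + (cos (\<phi> - t) - 1) * (x \<bullet> b)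
        = sin t * (x \<bullet> a) + (cos t - 1) * (x \<bullet> b)"
    proof -
      have "sin (\<phi> - t) * (x \<bullet> a) + (cos (\<phi> - t) - 1) * (x \<bullet> b)
        = r * (sin (\<phi> - t) * cos \<tau> + cos (\<phi> - t) * sin \<tau>) - x \<bullet> b"
        by (simp add: r algebra_simps)
      also have "\<dots> = r * sin (t + \<tau>) - x \<bullet> b" unfolding ang by simp
      finally show ?thesis by (simp add: r sin_add algebra_simps)
    qed
    have collect: "x + p *\<^sub>R a + q *\<^sub>R b - (2 * r) *\<^sub>R a = x + (p - 2 * r) *\<^sub>R a + q *\<^sub>R b" for p q r :: real
      by (simp add: scaleR_diff_left)
    show ?thesis
      unfolding reflection_def plane_rotation_coords[OF ab]
      unfolding plane_rotation_def ca cb collect ..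
  qed
  with \<phi> that show ?thesis by blast
qed

lemma reflection_involutive: "a \<bullet> a = 1 \<Longrightarrow> reflection a (reflection a x) = x"
  by (simp add: reflection_def inner_diff_left)

lemma orthogonal_reflection:
  assumes "a \<bullet> a = 1"
  shows "orthogonal_transformation (reflection a)"
  unfolding orthogonal_transformation
proof (intro conjI allI)
  show "linear (reflection a)"
    by (rule linearI) (simp_all add: reflection_def inner_add_left algebra_simps)
  show "norm (reflection a x) = norm x" for x
    using assms by (simp add: norm_eq reflection_def inner_diff_left inner_diff_right inner_commute[of a x])
qed

text \<open>Cartan--Dieudonne: if \<open>f x \<noteq> x\<close>, the reflection along \<open>f x - x\<close> takes \<open>f x\<close> back to \<open>x\<close>
  and fixes every fixed point of \<open>f\<close>, so composing with it enlarges the space of fixed points.\<close>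

lemma orthogonal_transformation_reflection_induct [consumes 1, case_names id reflection]:
  fixes f :: "'a::euclidean_space \<Rightarrow> 'a"
  assumes f: "orthogonal_transformation f"
    and id: "P (\<lambda>x. x)"
    and step: "\<And>a g. a \<bullet> a = 1 \<Longrightarrow> orthogonal_transformation g \<Longrightarrow> P g \<Longrightarrow> P (reflection a \<circ> g)"
  shows "P f"
  using f
proof (induction "DIM('a) - dim {x. f x = x}" arbitrary: f rule: less_induct)
  case less
  note f = less.prems
  then have lin: "linear f" by (rule orthogonal_transformation_linear)
  show ?case
  proof (cases "\<forall>x. f x = x")
    case True
    then have "f = (\<lambda>x. x)" by auto
    then show ?thesis using id by simp
  next
    case False
    then obtain x where x: "f x \<noteq> x" by blast
    define w where "w = f x - x"
    define a where "a = w /\<^sub>R norm w"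
    have w: "w \<noteq> 0" using x by (simp add: w_def)
    then have a1: "a \<bullet> a = 1" by (simp add: a_def dot_square_norm power2_eq_square)
    have refl: "reflection a y = y - (2 * (y \<bullet> w) / (w \<bullet> w)) *\<^sub>R w" for y
      using w by (simp add: reflection_def a_def dot_square_norm power2_eq_square divide_simps)
    have fx: "f x \<bullet> f x = x \<bullet> x" using f by (simp add: orthogonal_transformation_def)
    define g where "g = reflection a \<circ> f"
    have g: "orthogonal_transformation g"
      unfolding g_def by (intro orthogonal_transformation_compose orthogonal_reflection f a1)
    have gx: "g x = x"
    proof -
      have "2 * (f x \<bullet> w) = w \<bullet> w"
        using fx by (simp add: w_def inner_diff_left inner_diff_right inner_commute)
      then show ?thesis using w by (simp add: g_def refl w_def)
    qed
    have gy: "g y = y" if "f y = y" for y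
    proof -
      have "y \<bullet> f x = y \<bullet> x"
        using f that unfolding orthogonal_transformation_def by metis
      then have "f y \<bullet> w = 0" using that by (simp add: w_def inner_diff_right)
      then show ?thesis using that by (simp add: g_def refl)
    qed
    have sub: "subspace {x. h x = x}" if "linear h" for h :: "'a \<Rightarrow> 'a"
      using that by (auto simp: subspace_def linear_0 linear_add linear_scale)
    have "{x. f x = x} \<subset> {x. g x = x}" using gx gy x by blast
    then have "span {x. f x = x} \<subset> span {x. g x = x}"
      using sub[OF lin] sub[OF orthogonal_transformation_linear[OF g]] by (simp add: span_eq_iff[THEN iffD2])
    then have "dim {x. f x = x} < dim {x. g x = x}" by (rule dim_psubset)
    moreover have "dim {x. g x = x} \<le> DIM('a)" by (rule dim_subset_UNIV)
    ultimately have "P g" using less.hyps[OF _ g] by linarith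
    then have "P (reflection a \<circ> g)" using step a1 g by blast
    moreover have "reflection a \<circ> g = f" using a1 by (auto simp: g_def reflection_involutive)
    ultimately show ?thesis by simp
  qed
qed

text \<open>The half-open intervals match: \<open>t \<mapsto> \<phi> - t\<close> maps \<open>{0<..2 \<pi>}\<close> onto \<open>{\<phi> - 2 \<pi>..<\<phi>}\<close>,
  and moving the part of it below \<open>0\<close> by one period yields exactly \<open>{0..<2 \<pi>}\<close>.\<close>

lemma nn_integral_circle_reflect:
  fixes g :: "real \<Rightarrow> ennreal"
  assumes [measurable]: "g \<in> borel_measurable borel"
    and per: "\<And>t. g (t + 2 * pi) = g t" and \<phi>: "0 \<le> \<phi>" "\<phi> < 2 * pi"
  shows "(\<integral>\<^sup>+t. g (\<phi> - t) * indicator {0<..2 * pi} t \<partial>lborel) =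
    (\<integral>\<^sup>+t. g t * indicator {0..<2 * pi} t \<partial>lborel)"
proof -
  have "(\<integral>\<^sup>+t. g (\<phi> - t) * indicator {0<..2 * pi} t \<partial>lborel)
     = (\<integral>\<^sup>+u. g u * indicator {\<phi> - 2 * pi..<\<phi>} u \<partial>lborel)"
    by (subst nn_integral_real_affine[where c="-1" and t="\<phi>" and f="\<lambda>u. g u * indicator {\<phi> - 2 * pi..<\<phi>} u"])
      (auto intro!: nn_integral_cong split: split_indicator)
  also have "\<dots> = (\<integral>\<^sup>+u. g u * indicator {\<phi> - 2 * pi..<0} u + g u * indicator {0..<\<phi>} u \<partial>lborel)"
    using \<phi> by (intro nn_integral_cong) (auto split: split_indicator)
  also have "\<dots> = (\<integral>\<^sup>+u. g u * indicator {\<phi> - 2 * pi..<0} u \<partial>lborel) + (\<integral>\<^sup>+u. g u * indicator {0..<\<phi>} u \<partial>lborel)"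
    by (intro nn_integral_add) measurable
  also have "(\<integral>\<^sup>+u. g u * indicator {\<phi> - 2 * pi..<0} u \<partial>lborel) = (\<integral>\<^sup>+u. g u * indicator {\<phi>..<2 * pi} u \<partial>lborel)"
  proof -
    have "g (- (2 * pi) + u) = g u" for u using per[of "u - 2 * pi"] by simp
    then show ?thesis
      by (subst nn_integral_real_affine[where c=1 and t="- (2 * pi)" and f="\<lambda>u. g u * indicator {\<phi> - 2 * pi..<0} u"])
        (auto intro!: nn_integral_cong split: split_indicator)
  qed
  also have "(\<integral>\<^sup>+u. g u * indicator {\<phi>..<2 * pi} u \<partial>lborel) + (\<integral>\<^sup>+u. g u * indicator {0..<\<phi>} u \<partial>lborel)
     = (\<integral>\<^sup>+u. g u * indicator {\<phi>..<2 * pi} u + g u * indicator {0..<\<phi>} u \<partial>lborel)"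
    by (intro nn_integral_add[symmetric]) measurable
  also have "\<dots> = (\<integral>\<^sup>+t. g t * indicator {0..<2 * pi} t \<partial>lborel)"
    using \<phi> by (intro nn_integral_cong) (auto split: split_indicator)
  finally show ?thesis .
qed

lemma about_orthogonal:
  fixes f :: "'a::euclidean_space \<Rightarrow> 'a"
  assumes "orthogonal_transformation f"
  shows "about c f \<in> borel \<rightarrow>\<^sub>M borel" "norm (about c f x - about c f y) = norm (x - y)"
proof -
  have lin: "linear f" using assms by (rule orthogonal_transformation_linear)
  have "continuous_on UNIV f"
    using lin by (simp add: linear_continuous_on linear_conv_bounded_linear)
  from continuous_on_compose2[OF this, of UNIV "\<lambda>x. x - c"]
  have "continuous_on UNIV (\<lambda>x. f (x - c))" by (simp add: continuous_intros)
  then have "continuous_on UNIV (about c f)"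
    unfolding about_def[abs_def] by (intro continuous_intros)
  then show "about c f \<in> borel \<rightarrow>\<^sub>M borel" by (rule borel_measurable_continuous_onI)
  have "about c f x - about c f y = f (x - y)"
    using linear_diff[OF lin, of "x - c" "y - c"] by (simp add: about_def)
  then show "norm (about c f x - about c f y) = norm (x - y)"
    using assms by (simp add: orthogonal_transformation_norm)
qed

lemma distr_invariant_comp:
  assumes "sets \<rho> = sets borel" "S \<in> borel \<rightarrow>\<^sub>M borel" "T \<in> borel \<rightarrow>\<^sub>M borel"
    and "distr \<rho> borel S = \<rho>" "distr \<rho> borel T = \<rho>"
  shows "distr \<rho> borel (\<lambda>x. S (T x)) = \<rho>"
proof -
  have "T \<in> \<rho> \<rightarrow>\<^sub>M borel" using assms by (simp cong: measurable_cong_sets)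
  from distr_distr[OF assms(2) this] show ?thesis using assms by (simp add: comp_def)
qed

text \<open>Averaging over the circle of rotations, a test function and its reflection have the same
  mean on every orbit.\<close>

lemma reflection_invariant_of_rotations:
  fixes \<rho> :: "'a::euclidean_space measure"
  assumes \<rho>: "prob_space \<rho>" "sets \<rho> = sets borel" and ab: "orthonormal_pair a b"
    and inv: "\<And>t. distr \<rho> borel (about c (plane_rotation a b t)) = \<rho>"
  shows "distr \<rho> borel (about c (reflection a)) = \<rho>"
proof (rule measure_eqI)
  interpret prob_space \<rho> by fact
  interpret pair_sigma_finite lborel \<rho> ..
  have [measurable_cong]: "sets \<rho> = sets borel" by fact
  let ?S = "about c (reflection a)" and ?R = "\<lambda>t. about c (plane_rotation a b t)"
  have a1: "a \<bullet> a = 1" using ab by (simp add: orthonormal_pair_def)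
  have S[measurable]: "?S \<in> borel \<rightarrow>\<^sub>M borel"
    using a1 by (intro about_orthogonal orthogonal_reflection)
  have R[measurable]: "?R t \<in> borel \<rightarrow>\<^sub>M borel" for t
    using ab by (intro about_orthogonal orthogonal_plane_rotation)
  have RR[measurable]: "(\<lambda>(t, x). ?R t x) \<in> borel \<Otimes>\<^sub>M borel \<rightarrow>\<^sub>M borel"
    unfolding about_def plane_rotation_def by measurable
  fix A assume "A \<in> sets (distr \<rho> borel ?S)"
  then have A[measurable]: "A \<in> sets borel" by simp
  have rot: "(\<integral>\<^sup>+x. h (?R t x) \<partial>\<rho>) = (\<integral>\<^sup>+x. h x \<partial>\<rho>)" if [measurable]: "h \<in> borel_measurable borel" for h t
    by (subst (2) inv[of t, symmetric]) (simp add: nn_integral_distr)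
  \<comment> \<open>The interval \<open>I\<close> is left open because the reflected average is taken over \<open>{0<..2 * pi}\<close> and
    the direct one over \<open>{0..<2 * pi}\<close>.\<close>
  have avg: "ennreal (2 * pi) * (\<integral>\<^sup>+x. h x \<partial>\<rho>) = (\<integral>\<^sup>+x. \<integral>\<^sup>+t. h (?R t x) * indicator I t \<partial>lborel \<partial>\<rho>)"
    if h[measurable]: "h \<in> borel_measurable borel" and I[measurable]: "I \<in> sets borel" and "emeasure lborel I = 2 * pi"
    for h I
  proof -
    have "ennreal (2 * pi) * (\<integral>\<^sup>+x. h x \<partial>\<rho>) = (\<integral>\<^sup>+t. (\<integral>\<^sup>+x. h x \<partial>\<rho>) * indicator I t \<partial>lborel)"
      using that(3) by (subst nn_integral_cmult_indicator) (use I in \<open>simp_all add: mult.commute\<close>)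
    also have "\<dots> = (\<integral>\<^sup>+t. \<integral>\<^sup>+x. h (?R t x) * indicator I t \<partial>\<rho> \<partial>lborel)"
      using rot[OF h] by (simp add: nn_integral_multc)
    also have "\<dots> = (\<integral>\<^sup>+x. \<integral>\<^sup>+t. h (?R t x) * indicator I t \<partial>lborel \<partial>\<rho>)"
      by (intro Fubini'[symmetric]) measurable
    finally show ?thesis .
  qed
  let ?h = "indicator A :: 'a \<Rightarrow> ennreal"
  have per: "?R (t + 2 * pi) x = ?R t x" for t x
    by (simp add: about_def plane_rotation_def)
  have "ennreal (2 * pi) * (\<integral>\<^sup>+x. ?h (?S x) \<partial>\<rho>) =
      (\<integral>\<^sup>+x. \<integral>\<^sup>+t. ?h (?S (?R t x)) * indicator {0<..2 * pi} t \<partial>lborel \<partial>\<rho>)"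
    by (intro avg) (auto simp: pi_ge_zero)
  also have "\<dots> = (\<integral>\<^sup>+x. \<integral>\<^sup>+t. ?h (?R t x) * indicator {0..<2 * pi} t \<partial>lborel \<partial>\<rho>)"
  proof (rule nn_integral_cong)
    fix x
    obtain \<phi> where \<phi>: "0 \<le> \<phi>" "\<phi> < 2 * pi"
      "\<And>t. reflection a (plane_rotation a b t (x - c)) = plane_rotation a b (\<phi> - t) (x - c)"
      using reflection_of_rotated_point[OF ab] by metis
    have "?S (?R t x) = ?R (\<phi> - t) x" for t
      by (simp add: about_def \<phi>)
    moreover have "(\<lambda>t. ?h (?R t x)) \<in> borel_measurable borel" by measurable
    ultimately show "(\<integral>\<^sup>+t. ?h (?S (?R t x)) * indicator {0<..2 * pi} t \<partial>lborel) =
        (\<integral>\<^sup>+t. ?h (?R t x) * indicator {0..<2 * pi} t \<partial>lborel)"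
      using nn_integral_circle_reflect[of "\<lambda>t. ?h (?R t x)" \<phi>] \<phi> per by simp
  qed
  also have "\<dots> = ennreal (2 * pi) * (\<integral>\<^sup>+x. ?h x \<partial>\<rho>)"
    by (intro avg[symmetric]) (auto simp: pi_ge_zero)
  finally have "(\<integral>\<^sup>+x. ?h (?S x) \<partial>\<rho>) = (\<integral>\<^sup>+x. ?h x \<partial>\<rho>)"
    using pi_gt_zero by (subst (asm) ennreal_mult_cancel_left) (auto simp: ennreal_eq_0_iff)
  moreover have "emeasure (distr \<rho> borel ?S) A = (\<integral>\<^sup>+x. ?h (?S x) \<partial>\<rho>)"
    using nn_integral_distr[of ?S \<rho> borel ?h] by simp
  moreover have "(\<integral>\<^sup>+x. ?h x \<partial>\<rho>) = emeasure \<rho> A" by simp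
  ultimately show "emeasure (distr \<rho> borel ?S) A = emeasure \<rho> A" by (simp only:)
qed (use \<rho> in simp)

text \<open>In dimension at least two every unit vector \<open>a\<close> extends to an orthonormal pair, so that
  invariance under plane rotations yields invariance under each reflection, hence under all
  products of reflections.\<close>

lemma radial_about_of_plane_rotations:
  fixes \<rho> :: "'a::euclidean_space measure"
  assumes dim: "DIM('a) \<ge> 2" and \<rho>: "prob_space \<rho>" "sets \<rho> = sets borel"
    and inv: "\<And>a b t. orthonormal_pair a b \<Longrightarrow> distr \<rho> borel (about c (plane_rotation a b t)) = \<rho>"
  shows "radial_about c \<rho>"
proof -
  have "distr \<rho> borel (about c f) = \<rho>" if "orthogonal_transformation f" for f
    using that
  proof (induction rule: orthogonal_transformation_reflection_induct)
    case id
    have "distr \<rho> borel (\<lambda>x. x) = \<rho>" using \<rho> by (intro distr_id2) simp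
    then show ?case by (simp add: about_def[abs_def])
  next
    case (reflection a g)
    obtain y :: 'a where y: "y \<noteq> 0" "orthogonal a y"
      using orthogonal_to_vector_exists[OF dim, of a] by blast
    define b where "b = y /\<^sub>R norm y"
    have "orthonormal_pair a b"
      using reflection(1) y
      by (simp add: orthonormal_pair_def b_def orthogonal_def dot_square_norm power2_eq_square)
    then have "distr \<rho> borel (about c (reflection a)) = \<rho>"
      using reflection_invariant_of_rotations[OF \<rho>] inv by blast
    from distr_invariant_comp[OF \<rho>(2) about_orthogonal(1)[OF orthogonal_reflection[OF reflection(1)]]
        about_orthogonal(1)[OF reflection(2)] this reflection(3)]
    have "distr \<rho> borel (\<lambda>x. about c (reflection a) (about c g x)) = \<rho>" .
    then show ?case by (simp only: about_comp)
  qed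
  then show ?thesis by (simp add: radial_about_def about_def[abs_def])
qed

lemma ex_small_halving:
  fixes t :: real
  assumes "\<delta> > 0"
  obtains n where "\<bar>t / 2 ^ n\<bar> < \<delta>"
proof -
  have "(\<lambda>n. t / 2 ^ n) \<longlonglongrightarrow> 0"
    using LIMSEQ_inverse_realpow_zero[of 2] tendsto_mult_right_zero[of "\<lambda>n. inverse (2 ^ n)" sequentially t]
    by (simp add: divide_inverse)
  then have "\<forall>\<^sub>F n in sequentially. \<bar>t / 2 ^ n\<bar> < \<delta>"
    using assms by (auto simp: tendsto_iff dist_real_def)
  then show ?thesis using that by (auto simp: eventually_sequentially)
qed

lemma about_rotation_displacement:
  assumes ab: "orthonormal_pair a b" and x: "norm x \<le> B"
  shows "norm (about c (plane_rotation a b s) x - x) \<le> (4 * (\<bar>B\<bar> + norm c) + 1) * \<bar>s\<bar>"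
proof -
  have "norm (about c (plane_rotation a b s) x - x) \<le> 4 * \<bar>s\<bar> * norm (x - c)"
    using plane_rotation_displacement[OF ab, of s "x - c"] by (simp add: about_def algebra_simps)
  also have "\<dots> \<le> 4 * \<bar>s\<bar> * (\<bar>B\<bar> + norm c)"
    using x norm_triangle_ineq4[of x c] by (intro mult_left_mono) auto
  also have "\<dots> \<le> (4 * (\<bar>B\<bar> + norm c) + 1) * \<bar>s\<bar>" by (simp add: algebra_simps)
  finally show ?thesis .
qed

text \<open>Invariance under \<open>R\<^sub>t\<close> implies invariance under \<open>R\<^sub>2\<^sub>t\<close>, and every angle is reached from small
  ones by doubling.\<close>

lemma plane_rotation_invariant_of_small:
  fixes \<rho> :: "'a::euclidean_space measure"
  assumes s: "sets \<rho> = sets borel" and ab: "orthonormal_pair a b" and "\<delta> > 0"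
    and small: "\<And>t. \<bar>t\<bar> < \<delta> \<Longrightarrow> distr \<rho> borel (about c (plane_rotation a b t)) = \<rho>"
  shows "distr \<rho> borel (about c (plane_rotation a b t)) = \<rho>"
proof -
  have m: "about c (plane_rotation a b t) \<in> borel \<rightarrow>\<^sub>M borel" for t
    using ab by (intro about_orthogonal orthogonal_plane_rotation)
  have dbl: "distr \<rho> borel (about c (plane_rotation a b (2 * t))) = \<rho>"
    if "distr \<rho> borel (about c (plane_rotation a b t)) = \<rho>" for t
  proof -
    have "about c (plane_rotation a b (2 * t)) =
        (\<lambda>x. about c (plane_rotation a b t) (about c (plane_rotation a b t) x))"
      by (auto simp: about_def plane_rotation_add[OF ab])
    then show ?thesis using distr_invariant_comp[OF s m m that that] by simp
  qed
  have pw: "distr \<rho> borel (about c (plane_rotation a b (2 ^ n * t))) = \<rho>"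
    if "distr \<rho> borel (about c (plane_rotation a b t)) = \<rho>" for t n
    using that
  proof (induction n)
    case (Suc n)
    then show ?case using dbl[of "2 ^ n * t"] by (simp add: mult.assoc)
  qed simp
  obtain n where "\<bar>t / 2 ^ n\<bar> < \<delta>" using ex_small_halving[OF \<open>\<delta> > 0\<close>] .
  from pw[OF small[OF this], of n] show ?thesis by simp
qed

section \<open>Transport couplings and finiteness of the energy\<close>

text \<open>Two random variables on a common probability space that stay within distance \<open>\<delta>\<close> provide a
  transport plan supported in the closed set \<open>{(x, y). |x - y| \<le> \<delta>}\<close>.\<close>

lemma d_inf_distr_le:
  fixes X Y :: "'m \<Rightarrow> 'a::euclidean_space"
  assumes M: "prob_space M" and X[measurable]: "X \<in> M \<rightarrow>\<^sub>M borel" and Y[measurable]: "Y \<in> M \<rightarrow>\<^sub>M borel"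
    and le: "AE z in M. norm (X z - Y z) \<le> \<delta>"
  shows "d_inf (distr M borel X) (distr M borel Y) \<le> ereal \<delta>"
proof -
  interpret prob_space M by fact
  define \<pi> where "\<pi> = distr M borel (\<lambda>z. (X z, Y z))"
  have XY: "(\<lambda>z. (X z, Y z)) \<in> M \<rightarrow>\<^sub>M borel" by (simp add: borel_prod[symmetric])
  have "prob_space \<pi>" unfolding \<pi>_def by (rule prob_space_distr[OF XY])
  moreover have "(fst :: 'a \<times> 'a \<Rightarrow> 'a) \<in> borel \<rightarrow>\<^sub>M borel" "(snd :: 'a \<times> 'a \<Rightarrow> 'a) \<in> borel \<rightarrow>\<^sub>M borel"
    by (simp_all add: borel_prod[symmetric])
  then have "distr \<pi> borel fst = distr M borel X" "distr \<pi> borel snd = distr M borel Y"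
    unfolding \<pi>_def by (simp_all add: distr_distr[OF _ XY] comp_def)
  ultimately have \<pi>: "\<pi> \<in> transport_plans (distr M borel X) (distr M borel Y)"
    by (simp add: transport_plans_def borel_prob_def \<pi>_def)
  have cl: "closed {p :: 'a \<times> 'a. norm (fst p - snd p) \<le> \<delta>}"
    by (intro closed_Collect_le continuous_intros)
  have "AE p in \<pi>. p \<in> {p. norm (fst p - snd p) \<le> \<delta>}"
    unfolding \<pi>_def using le cl by (subst AE_distr_iff[OF XY]) auto
  from msupp_subset_closed[OF _ cl this]
  have "msupp \<pi> \<subseteq> {p. norm (fst p - snd p) \<le> \<delta>}" by (simp add: \<pi>_def)
  then have "(SUP p\<in>msupp \<pi>. ereal (norm (fst p - snd p))) \<le> ereal \<delta>"
    by (intro SUP_least) auto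
  then show ?thesis
    unfolding d_inf_def using \<pi> by (rule INF_lower2[rotated])
qed

text \<open>The plan that moves half of the mass by \<open>T\<close> and leaves the other half at rest.\<close>

lemma d_inf_midpoint_le:
  fixes \<rho> :: "'a::euclidean_space measure"
  assumes \<rho>: "\<rho> \<in> borel_prob" and T[measurable]: "T \<in> borel \<rightarrow>\<^sub>M borel"
    and "0 \<le> \<delta>" and le: "AE x in \<rho>. norm (T x - x) \<le> \<delta>"
  shows "d_inf \<rho> (mix_measure (1/2) \<rho> (1/2) (distr \<rho> borel T)) \<le> ereal \<delta>"
proof -
  note r = borel_probD[OF \<rho>]
  have [measurable_cong]: "sets \<rho> = sets borel" by fact
  have D: "(\<lambda>x. (x, x)) \<in> borel \<rightarrow>\<^sub>M (borel :: ('a \<times> 'a) measure)"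
    and DT: "(\<lambda>x. (x, T x)) \<in> borel \<rightarrow>\<^sub>M (borel :: ('a \<times> 'a) measure)"
    by (simp_all add: borel_prod[symmetric])
  have D': "(\<lambda>x. (x, x)) \<in> \<rho> \<rightarrow>\<^sub>M (borel :: ('a \<times> 'a) measure)"
    and DT': "(\<lambda>x. (x, T x)) \<in> \<rho> \<rightarrow>\<^sub>M (borel :: ('a \<times> 'a) measure)"
    using D DT by measurable
  have F: "(fst :: 'a \<times> 'a \<Rightarrow> 'a) \<in> borel \<rightarrow>\<^sub>M borel" and S: "(snd :: 'a \<times> 'a \<Rightarrow> 'a) \<in> borel \<rightarrow>\<^sub>M borel"
    by (simp_all add: borel_prod[symmetric])
  let ?D = "distr \<rho> borel (\<lambda>x. (x, x))" and ?DT = "distr \<rho> borel (\<lambda>x. (x, T x))"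
  let ?M = "mix_measure (1/2) ?D (1/2) ?DT"
  have M: "?M \<in> borel_prob" by (intro borel_prob_mix borel_prob_distr \<rho> D DT) auto
  have id: "distr \<rho> borel (\<lambda>x. x) = \<rho>" using r by (intro distr_id2) simp
  have dd: "distr ?D borel fst = \<rho>" "distr ?DT borel fst = \<rho>" "distr ?D borel snd = \<rho>"
    "distr ?DT borel snd = distr \<rho> borel T"
    using id by (simp_all add: distr_distr[OF F D'] distr_distr[OF F DT'] distr_distr[OF S D'] distr_distr[OF S DT'] comp_def)
  have fst: "distr ?M borel fst = \<rho>"
    using r F by (simp add: distr_mix_measure dd mix_measure_self)
  have snd: "distr ?M borel snd = mix_measure (1/2) \<rho> (1/2) (distr \<rho> borel T)"
    using r S by (simp add: distr_mix_measure dd)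
  have cl: "{p :: 'a \<times> 'a. norm (fst p - snd p) \<le> \<delta>} \<in> sets borel"
    by (intro borel_closed closed_Collect_le continuous_intros)
  have "AE p in ?D. norm (fst p - snd p) \<le> \<delta>"
    using \<open>0 \<le> \<delta>\<close> cl by (subst AE_distr_iff[OF D']) auto
  moreover have "AE p in ?DT. norm (fst p - snd p) \<le> \<delta>"
    using le cl by (subst AE_distr_iff[OF DT']) (auto simp: norm_minus_commute)
  ultimately have "AE p in ?M. norm (fst p - snd p) \<le> \<delta>" by (intro AE_mix_measure) auto
  from d_inf_distr_le[OF borel_probD(1)[OF M] _ _ this] show ?thesis
    using F S by (simp add: fst snd cong: measurable_cong_sets)
qed

context radial_kernel
begin

lemma nn_integral_kernel_bounded:
  assumes "locally_integrable W"
  shows "(\<integral>\<^sup>+x\<in>cball 0 r. kernel x \<partial>lborel) < \<infinity>"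
proof -
  have "kernel x \<le> e2ennreal \<bar>W x\<bar> + ennreal (- b)" for x
  proof (cases "W x")
    case (real w)
    then have "kernel x = ennreal (w - b)" by (simp add: kernel_def)
    also have "\<dots> \<le> ennreal (\<bar>w\<bar> + - b)" by (intro ennreal_leI) auto
    also have "\<dots> = ennreal \<bar>w\<bar> + ennreal (- b)" using b_nonpos by (intro ennreal_plus) auto
    finally show ?thesis using real by simp
  qed (use W_lower[of x] in \<open>auto simp: kernel_def\<close>)
  moreover have [measurable]: "cball (0::'a) r \<in> sets borel" by simp
  have meas: "(\<lambda>x. e2ennreal \<bar>W x\<bar> * indicator (cball 0 r) x) \<in> borel_measurable borel"
    "(\<lambda>x::'a. ennreal (- b) * indicator (cball 0 r) x) \<in> borel_measurable borel"
    by measurable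
  ultimately have "(\<integral>\<^sup>+x\<in>cball 0 r. kernel x \<partial>lborel)
      \<le> (\<integral>\<^sup>+x. e2ennreal \<bar>W x\<bar> * indicator (cball 0 r) x + ennreal (- b) * indicator (cball 0 r) x \<partial>lborel)"
    by (intro nn_integral_mono) (auto split: split_indicator)
  also have "\<dots> = (\<integral>\<^sup>+x\<in>cball 0 r. e2ennreal \<bar>W x\<bar> \<partial>lborel) + ennreal (- b) * emeasure lborel (cball (0::'a) r)"
    using meas by (simp add: nn_integral_add nn_integral_cmult_indicator)
  also have "\<dots> < \<infinity>"
    using assms emeasure_lborel_cball_finite[of "0::'a" r]
    by (auto simp: locally_integrable_def ennreal_mult_less_top)
  finally show ?thesis .
qed

text \<open>Convolving with a uniform distribution on a small ball moves mass by at most the radius, and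
  local integrability of the kernel makes the potential of the result locally bounded.\<close>

lemma ex_near_measure_finite_energy:
  assumes loc: "locally_integrable W" and \<rho>: "\<rho> \<in> borel_prob" and B: "AE x in \<rho>. norm x \<le> B"
    and "\<delta> > 0"
  obtains \<nu> where "\<nu> \<in> borel_prob" "compactly_supported \<nu>" "d_inf \<rho> \<nu> \<le> ereal \<delta>" "cross_energy \<nu> \<nu> < \<infinity>"
proof -
  note r = borel_probD[OF \<rho>]
  have [measurable_cong]: "sets \<rho> = sets borel" by fact
  let ?C = "cball (0::'a) \<delta>"
  define \<eta> where "\<eta> = uniform_measure lborel ?C"
  have vol: "emeasure lborel ?C \<noteq> 0" "emeasure lborel ?C < \<infinity>"
    using content_cball_pos[OF \<open>\<delta> > 0\<close>, of "0::'a"] emeasure_lborel_cball_finite[of "0::'a" \<delta>]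
    by (auto simp: measure_def)
  have \<eta>s[measurable_cong]: "sets \<eta> = sets borel" by (simp add: \<eta>_def)
  interpret R: prob_space \<rho> by fact
  interpret N: prob_space \<eta>
    unfolding \<eta>_def using vol by (intro prob_space_uniform_measure) auto
  interpret P: pair_prob_space \<rho> \<eta> ..
  let ?M = "\<rho> \<Otimes>\<^sub>M \<eta>" and ?Y = "\<lambda>(x, u). x + u"
  define \<nu> where "\<nu> = distr ?M borel ?Y"
  have Y[measurable]: "?Y \<in> ?M \<rightarrow>\<^sub>M borel" by measurable
  have F[measurable]: "fst \<in> ?M \<rightarrow>\<^sub>M borel" by measurable
  have \<nu>: "\<nu> \<in> borel_prob"
    unfolding \<nu>_def by (intro borel_probI P.prob_space_distr Y) simp
  have \<eta>AE: "AE u in \<eta>. norm u \<le> \<delta>"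
    unfolding \<eta>_def by (intro AE_uniform_measureI) auto
  have "AE p in ?M. norm (fst p - ?Y p) \<le> \<delta>"
    using \<eta>AE by (intro P.AE_pair_measure) (auto simp: split_beta')
  from d_inf_distr_le[OF P.prob_space_axioms F Y this]
  have "d_inf (distr ?M borel fst) \<nu> \<le> ereal \<delta>" by (simp add: \<nu>_def)
  moreover have "distr ?M borel fst = \<rho>"
    using N.distr_pair_fst[of \<rho>] r by (simp cong: distr_cong)
  ultimately have d: "d_inf \<rho> \<nu> \<le> ereal \<delta>" by simp
  have "AE p in ?M. norm (?Y p) \<le> B + \<delta>"
  proof (intro P.AE_pair_measure)
    show "AE x in \<rho>. AE u in \<eta>. norm (?Y (x, u)) \<le> B + \<delta>"
      using B
    proof eventually_elim
      case (elim x)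
      show ?case using \<eta>AE by eventually_elim (use elim norm_triangle_ineq[of x] in \<open>auto intro: order_trans add_mono\<close>)
    qed
  qed measurable
  then have \<nu>B: "AE z in \<nu>. norm z \<le> B + \<delta>"
    unfolding \<nu>_def by (subst AE_distr_iff[OF Y]) auto
  then have cs: "compactly_supported \<nu>"
    using \<nu> by (subst compactly_supported_iff_AE_bounded) (auto dest: borel_probD)
  \<comment> \<open>\<open>r\<close> bounds \<open>x + u - z\<close> for \<open>x\<close> and \<open>z\<close> in the two supports and \<open>u\<close> in the small ball, so \<open>L\<close>
    bounds the potential of \<open>\<nu>\<close> on the support of \<open>\<nu>\<close>.\<close>
  define r where "r = 2 * B + 2 * \<delta>"
  define L where "L = (\<integral>\<^sup>+x\<in>cball 0 r. kernel x \<partial>lborel) / emeasure lborel ?C"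
  have "L < \<infinity>"
    using nn_integral_kernel_bounded[OF loc, of r] vol unfolding L_def
    unfolding infinity_ennreal_def top.not_eq_extremum[symmetric]
    by (simp add: ennreal_divide_eq_top_iff)
  have inner: "(\<integral>\<^sup>+u. kernel (z - (x + u)) \<partial>\<eta>) \<le> L" if "norm z \<le> B + \<delta>" "norm x \<le> B" for x z
  proof -
    have "norm (x - z) \<le> 2 * B + \<delta>"
      using that norm_triangle_ineq4[of x z] by linarith
    then have sub: "x - z + u \<in> cball 0 r" if "u \<in> ?C" for u
      using that norm_triangle_ineq[of "x - z" u] by (auto simp: r_def)
    have "(\<integral>\<^sup>+u. kernel (z - (x + u)) \<partial>\<eta>) =
        (\<integral>\<^sup>+u. kernel (z - (x + u)) * indicator ?C u \<partial>lborel) / emeasure lborel ?C"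
      unfolding \<eta>_def by (intro nn_integral_uniform_measure) auto
    also have "\<dots> \<le> L"
      unfolding L_def
    proof (intro divide_right_mono_ennreal)
      have "(\<integral>\<^sup>+u. kernel (z - (x + u)) * indicator ?C u \<partial>lborel)
          \<le> (\<integral>\<^sup>+u. kernel (x - z + u) * indicator (cball 0 r) (x - z + u) \<partial>lborel)"
      proof (intro nn_integral_mono)
        fix u
        have "x - z + u = - (z - (x + u))" by simp
        then have "kernel (z - (x + u)) = kernel (x - z + u)"
          by (intro kernel_radial) (simp only: norm_minus_cancel)
        then show "kernel (z - (x + u)) * indicator ?C u \<le> kernel (x - z + u) * indicator (cball 0 r) (x - z + u)"
          using sub[of u] by (auto split: split_indicator)
      qed
      also have "\<dots> = (\<integral>\<^sup>+x\<in>cball 0 r. kernel x \<partial>lborel)"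
      proof -
        have [measurable]: "cball (0::'a) r \<in> sets borel" by simp
        have "(\<lambda>x. kernel x * indicator (cball 0 r) x) \<in> borel_measurable borel" by measurable
        then show ?thesis
          using nn_integral_distr[of "(+) (x - z)" lborel borel "\<lambda>x. kernel x * indicator (cball 0 r) x"]
          by (simp add: lborel_distr_plus)
      qed
      finally show "(\<integral>\<^sup>+u. kernel (z - (x + u)) * indicator ?C u \<partial>lborel) \<le> (\<integral>\<^sup>+x\<in>cball 0 r. kernel x \<partial>lborel)" .
    qed
    finally show ?thesis .
  qed
  have pot: "shifted_potential \<nu> z \<le> L" if z: "norm z \<le> B + \<delta>" for z
  proof -
    have "shifted_potential \<nu> z = (\<integral>\<^sup>+p. kernel (z - ?Y p) \<partial>?M)"
      unfolding shifted_potential_def \<nu>_def by (subst nn_integral_distr) auto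
    also have "\<dots> = (\<integral>\<^sup>+x. \<integral>\<^sup>+u. kernel (z - (x + u)) \<partial>\<eta> \<partial>\<rho>)"
      by (subst N.nn_integral_fst[symmetric]) (auto simp: split_beta')
    also have "\<dots> \<le> (\<integral>\<^sup>+x. L \<partial>\<rho>)"
    proof (rule nn_integral_mono_AE)
      show "AE x in \<rho>. (\<integral>\<^sup>+u. kernel (z - (x + u)) \<partial>\<eta>) \<le> L"
        using B by eventually_elim (rule inner[OF z])
    qed
    also have "\<dots> = L" by (simp add: R.emeasure_space_1)
    finally show ?thesis .
  qed
  have "cross_energy \<nu> \<nu> \<le> (\<integral>\<^sup>+z. L \<partial>\<nu>)"
    unfolding cross_energy_def
  proof (rule nn_integral_mono_AE)
    show "AE z in \<nu>. shifted_potential \<nu> z \<le> L"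
      using \<nu>B by eventually_elim (rule pot)
  qed
  also have "\<dots> = L"
    using prob_space.emeasure_space_1[OF borel_probD(1)[OF \<nu>]] by simp
  finally have "cross_energy \<nu> \<nu> < \<infinity>" using \<open>L < \<infinity>\<close> by (rule le_less_trans)
  with \<nu> cs d that show ?thesis by blast
qed

text \<open>A local minimizer has at most the energy of its neighbours, and some of those are finite.\<close>

lemma local_minimizer_finite_energy:
  assumes loc: "locally_integrable W" and \<rho>: "\<rho> \<in> borel_prob" "compactly_supported \<rho>"
    and min: "d_inf_local_minimizer W \<rho>"
  shows "energy W \<rho> < \<infinity>"
proof -
  obtain B where B: "AE x in \<rho>. norm x \<le> B"
    using compactly_supportedE[OF \<rho>] .
  obtain \<epsilon> where \<epsilon>: "\<epsilon> > 0" "\<And>\<nu>. \<nu> \<in> borel_prob \<Longrightarrow> compactly_supported \<nu> \<Longrightarrow> d_inf \<rho> \<nu> < ereal \<epsilon> \<Longrightarrow> energy W \<rho> \<le> energy W \<nu>"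
    using min unfolding d_inf_local_minimizer_def by blast
  obtain \<nu> where \<nu>: "\<nu> \<in> borel_prob" "compactly_supported \<nu>" "d_inf \<rho> \<nu> \<le> ereal (\<epsilon> / 2)" "cross_energy \<nu> \<nu> < \<infinity>"
    using ex_near_measure_finite_energy[OF loc \<rho>(1) B, of "\<epsilon> / 2"] \<open>\<epsilon> > 0\<close> by auto
  have "ereal (\<epsilon> / 2) < ereal \<epsilon>" using \<open>\<epsilon> > 0\<close> by simp
  with \<nu>(3) have "d_inf \<rho> \<nu> < ereal \<epsilon>" by (rule le_less_trans)
  then have "energy W \<rho> \<le> energy W \<nu>" using \<epsilon> \<nu> by blast
  also have "\<dots> < \<infinity>" using \<nu> energy_finite_iff by blast
  finally show ?thesis .
qed

end

section \<open>Local minimizers\<close>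

lemma AE_bounded_about:
  fixes \<rho> :: "'a::euclidean_space measure"
  assumes "sets \<rho> = sets borel" and f: "orthogonal_transformation f" and B: "AE x in \<rho>. norm x \<le> B"
  shows "AE x in distr \<rho> borel (about c f). norm x \<le> B + 2 * norm c"
proof -
  have m: "about c f \<in> \<rho> \<rightarrow>\<^sub>M borel"
    using about_orthogonal(1)[OF f] assms(1) by (simp cong: measurable_cong_sets)
  have "norm (about c f x) \<le> norm x + 2 * norm c" for x
    using norm_triangle_ineq[of c "f (x - c)"] norm_triangle_ineq4[of x c]
      orthogonal_transformation_norm[OF f, of "x - c"]
    by (simp add: about_def)
  then have le: "norm (about c f x) \<le> B + 2 * norm c" if "norm x \<le> B" for x
    using that by (meson add_right_mono order_trans)
  have "AE x in \<rho>. norm (about c f x) \<le> B + 2 * norm c"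
    using B by eventually_elim (rule le)
  then show ?thesis by (subst AE_distr_iff[OF m]) auto
qed

lemma center_of_mass_about:
  fixes \<rho> :: "'a::euclidean_space measure"
  assumes \<rho>: "\<rho> \<in> borel_prob" "integrable \<rho> (\<lambda>x. x)" and f: "orthogonal_transformation f"
  shows "center_of_mass (distr \<rho> borel (about (center_of_mass \<rho>) f)) = center_of_mass \<rho>"
proof -
  note r = borel_probD[OF \<rho>(1)]
  interpret prob_space \<rho> by fact
  let ?c = "center_of_mass \<rho>"
  have bl: "bounded_linear f"
    using f by (simp add: orthogonal_transformation_linear linear_conv_bounded_linear[symmetric])
  have m: "about ?c f \<in> \<rho> \<rightarrow>\<^sub>M borel"
    using about_orthogonal(1)[OF f] r by (simp cong: measurable_cong_sets)
  have i: "integrable \<rho> (\<lambda>x. x - ?c)" using \<rho>(2) by simp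
  have "center_of_mass (distr \<rho> borel (about ?c f)) = (LINT x|\<rho>. ?c + f (x - ?c))"
    unfolding center_of_mass_def[of "distr _ _ _"] using m by (subst integral_distr) (auto simp: about_def[abs_def])
  also have "\<dots> = ?c + (LINT x|\<rho>. f (x - ?c))"
    using integrable_bounded_linear[OF bl i] by (simp add: prob_space)
  also have "(LINT x|\<rho>. f (x - ?c)) = f (LINT x|\<rho>. x - ?c)"
    by (rule integral_bounded_linear[OF bl i])
  also have "(LINT x|\<rho>. x - ?c) = 0"
    using \<rho>(2) by (simp add: prob_space center_of_mass_def)
  finally show ?thesis using linear_0[OF orthogonal_transformation_linear[OF f]] by simp
qed

context radial_kernel
begin

text \<open>A slightly rotated copy of \<open>\<rho>\<close> has the same energy, so if it were different from \<open>\<rho>\<close> their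
  midpoint would be a nearby competitor of smaller energy.\<close>

lemma local_minimizer_rotation_invariant:
  assumes loc: "locally_integrable W" and LIC: "LIC W"
    and \<rho>: "\<rho> \<in> borel_prob" "compactly_supported \<rho>"
    and min: "d_inf_local_minimizer W \<rho>" and ab: "orthonormal_pair u v"
  shows "distr \<rho> borel (about (center_of_mass \<rho>) (plane_rotation u v t)) = \<rho>"
proof -
  note r = borel_probD[OF \<rho>(1)]
  let ?c = "center_of_mass \<rho>"
  obtain B where B: "AE x in \<rho>. norm x \<le> B"
    using compactly_supportedE[OF \<rho>] .
  obtain \<epsilon> where \<epsilon>: "\<epsilon> > 0" "\<And>\<nu>. \<nu> \<in> borel_prob \<Longrightarrow> compactly_supported \<nu> \<Longrightarrow> d_inf \<rho> \<nu> < ereal \<epsilon> \<Longrightarrow> energy W \<rho> \<le> energy W \<nu>"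
    using min unfolding d_inf_local_minimizer_def by blast
  have fin: "energy W \<rho> < \<infinity>" by (rule local_minimizer_finite_energy[OF loc \<rho> min])
  \<comment> \<open>A Lipschitz constant in the angle, uniform on the support; the summand \<open>1\<close> makes it positive.\<close>
  define K where "K = 4 * (\<bar>B\<bar> + norm ?c) + 1"
  have K: "K > 0" unfolding K_def by (simp add: add_nonneg_pos)
  have "distr \<rho> borel (about ?c (plane_rotation u v s)) = \<rho>" if s: "\<bar>s\<bar> < \<epsilon> / K" for s
  proof (rule ccontr)
    let ?T = "about ?c (plane_rotation u v s)"
    let ?\<nu> = "distr \<rho> borel ?T"
    let ?m = "mix_measure (1/2) \<rho> (1/2) ?\<nu>"
    assume ne: "?\<nu> \<noteq> \<rho>"
    have orth: "orthogonal_transformation (plane_rotation u v s)" by (rule orthogonal_plane_rotation[OF ab])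
    note T = about_orthogonal[OF orth, of ?c]
    have \<nu>: "?\<nu> \<in> borel_prob" by (rule borel_prob_distr[OF \<rho>(1) T(1)])
    have m: "?m \<in> borel_prob" by (intro borel_prob_mix \<rho> \<nu>) auto
    have \<nu>B: "AE x in ?\<nu>. norm x \<le> B + 2 * norm ?c" by (rule AE_bounded_about[OF r(2) orth B])
    have "AE x in \<rho>. norm x \<le> B + 2 * norm ?c" using B by eventually_elim (use norm_ge_zero[of ?c] in linarith)
    then have "AE x in ?m. norm x \<le> B + 2 * norm ?c" using \<nu>B r by (intro AE_mix_measure) auto
    then have cs: "compactly_supported ?m" by (subst compactly_supported_iff_AE_bounded) auto
    have "AE x in \<rho>. norm (?T x - x) \<le> K * \<bar>s\<bar>"
      using B by eventually_elim (unfold K_def, rule about_rotation_displacement[OF ab])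
    from d_inf_midpoint_le[OF \<rho>(1) T(1) _ this]
    have "d_inf \<rho> ?m \<le> ereal (K * \<bar>s\<bar>)" using K by simp
    also have "\<dots> < ereal \<epsilon>" using s K by (simp add: field_simps)
    finally have "energy W \<rho> \<le> energy W ?m" using \<epsilon> m cs by blast
    moreover have eq: "energy W ?\<nu> = energy W \<rho>" by (rule energy_isometry[OF \<rho>(1) T])
    have "energy W ?m < ereal (1/2) * energy W \<rho> + ereal (1/2) * energy W ?\<nu>"
      using borel_prob2_of_bounded[OF \<rho>(1) B] borel_prob2_of_bounded[OF \<nu> \<nu>B] ne fin LIC
        center_of_mass_about[OF \<rho>(1) _ orth]
      by (intro LIC_midpoint) (auto simp: eq)
    moreover have "ereal (1/2) * e + ereal (1/2) * e = e" for e by (cases e) auto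
    ultimately show False by (simp add: eq)
  qed
  moreover have "\<epsilon> / K > 0" using \<epsilon>(1) K by simp
  ultimately show ?thesis
    by (rule plane_rotation_invariant_of_small[OF r(2) ab, rotated])
qed

end

section \<open>Steady states\<close>

text \<open>Otherwise \<open>v\<close> decreases at rate \<open>|g|\<close> in direction \<open>- g\<close>, which the liminf defining the
  subdifferential excludes.\<close>

lemma gradient_zero_of_subdifferential:
  fixes V :: "'a::euclidean_space \<Rightarrow> ereal"
  assumes V: "\<And>y. V y = ereal (v y)" and d: "(v has_derivative (\<lambda>h. g \<bullet> h)) (at x)"
    and sub: "0 \<in> subdifferential V x"
  shows "g = 0"
proof (rule ccontr)
  assume "g \<noteq> 0"
  define e where "e = norm g / 4"
  have e: "e > 0" using \<open>g \<noteq> 0\<close> by (simp add: e_def)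
  obtain d1 where d1: "d1 > 0" "\<And>y. norm (y - x) < d1 \<Longrightarrow> norm (v y - v x - g \<bullet> (y - x)) \<le> e * norm (y - x)"
    using d e unfolding has_derivative_at_alt by blast
  have "0 \<le> Liminf (at x) (\<lambda>y. (V y - V x - ereal (0 \<bullet> (y - x))) / ereal (norm (y - x)))"
    using sub by (simp add: subdifferential_def)
  then have "\<forall>\<^sub>F y in at x. ereal (- (2 * e)) < (V y - V x - ereal (0 \<bullet> (y - x))) / ereal (norm (y - x))"
    using e unfolding le_Liminf_iff by (elim allE[of _ "ereal (- (2 * e))"]) simp
  then obtain d2 where d2: "d2 > 0" "\<And>y. y \<noteq> x \<Longrightarrow> dist y x < d2 \<Longrightarrow>
      ereal (- (2 * e)) < (V y - V x - ereal (0 \<bullet> (y - x))) / ereal (norm (y - x))"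
    unfolding eventually_at by blast
  \<comment> \<open>A step along \<open>- g\<close> of length half the smaller of the two radii.\<close>
  define t where "t = min d1 d2 / (2 * norm g)"
  have t: "t > 0" using d1 d2 \<open>g \<noteq> 0\<close> by (simp add: t_def)
  define y where "y = x - t *\<^sub>R g"
  have n: "norm (y - x) = t * norm g" using t by (simp add: y_def)
  have np: "norm (y - x) > 0" using n t \<open>g \<noteq> 0\<close> by simp
  have "t * norm g = min d1 d2 / 2" using \<open>g \<noteq> 0\<close> by (simp add: t_def)
  then have small: "norm (y - x) < d1" "dist y x < d2" using n d1 d2 by (auto simp: dist_norm)
  have "y \<noteq> x" using np by auto
  from d2(2)[OF this small(2)] have "- (2 * e) < (v y - v x) / norm (y - x)"
    using np by (simp add: V)
  then have "- (2 * e) * norm (y - x) < v y - v x"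
    using np by (simp add: field_simps)
  moreover have "v y - v x \<le> g \<bullet> (y - x) + e * norm (y - x)"
    using d1(2)[OF small(1)] by (simp add: abs_le_iff)
  moreover have "g \<bullet> (y - x) = - (4 * e) * norm (y - x)"
    by (simp add: n e_def) (simp add: y_def dot_square_norm power2_eq_square)
  ultimately have "e * norm (y - x) < 0" by (simp add: algebra_simps)
  then show False using e np by (simp add: mult_less_0_iff)
qed

text \<open>Second-order Taylor expansion at a critical point with positive semidefinite Hessian; the
  error is uniform since the Hessian is uniformly continuous on bounded sets.\<close>

lemma taylor_lower_bound:
  fixes v :: "'a::euclidean_space \<Rightarrow> real" and H :: "'a \<Rightarrow> 'a \<Rightarrow>\<^sub>L 'a"
  assumes v: "\<And>x. (v has_derivative (\<lambda>h. G x \<bullet> h)) (at x)"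
    and G: "\<And>x. (G has_derivative blinfun_apply (H x)) (at x)"
    and H: "continuous_on UNIV H" and "\<eta> > 0"
  obtains \<delta> where "\<delta> > 0" "\<And>x y. norm x \<le> B \<Longrightarrow> norm (y - x) < \<delta> \<Longrightarrow> G x = 0 \<Longrightarrow>
    positive_semidefinite (H x) \<Longrightarrow> v x \<le> v y + \<eta> * (norm (y - x))\<^sup>2"
proof -
  have "uniformly_continuous_on (cball 0 (B + 1)) H"
    by (intro compact_uniformly_continuous continuous_on_subset[OF H]) auto
  then obtain d where d: "d > 0" "\<And>x y. x \<in> cball 0 (B + 1) \<Longrightarrow> y \<in> cball 0 (B + 1) \<Longrightarrow>
      dist y x < d \<Longrightarrow> dist (H y) (H x) < \<eta>"
    using \<open>\<eta> > 0\<close> unfolding uniformly_continuous_on_def by meson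
  show ?thesis
  proof (rule that[of "min 1 d"])
    fix x y assume x: "norm x \<le> B" and y: "norm (y - x) < min 1 d" and G0: "G x = 0"
      and psd: "positive_semidefinite (H x)"
    define h where "h = y - x"
    have line: "((\<lambda>t. x + t *\<^sub>R h) has_derivative (\<lambda>s. s *\<^sub>R h)) (at t)" for t
      by (auto intro!: derivative_eq_intros)
    have dv: "((\<lambda>t. v (x + t *\<^sub>R h)) has_field_derivative (G (x + t *\<^sub>R h) \<bullet> h)) (at t)" for t
      using has_derivative_compose[OF line v[of "x + t *\<^sub>R h"]]
      by (simp add: has_field_derivative_def mult_commute_abs)
    have dG: "((\<lambda>t. G (x + t *\<^sub>R h) \<bullet> h) has_field_derivative (H (x + t *\<^sub>R h) h \<bullet> h)) (at t)" for t
      using has_derivative_inner_left[OF has_derivative_compose[OF line G[of "x + t *\<^sub>R h"]], of h]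
      by (simp add: has_field_derivative_def mult_commute_abs blinfun.scaleR_right)
    \<comment> \<open>Two mean values along the segment: first of \<open>v\<close>, then of \<open>G \<bullet> h\<close>, which vanishes at \<open>x\<close>.\<close>
    obtain t where t: "0 < t" "t < 1" "v (x + 1 *\<^sub>R h) - v (x + 0 *\<^sub>R h) = (1 - 0) * (G (x + t *\<^sub>R h) \<bullet> h)"
      using MVT2[of 0 1 "\<lambda>t. v (x + t *\<^sub>R h)" "\<lambda>t. G (x + t *\<^sub>R h) \<bullet> h"] dv by auto
    obtain s where s: "0 < s" "s < t" "G (x + t *\<^sub>R h) \<bullet> h - G (x + 0 *\<^sub>R h) \<bullet> h = (t - 0) * (H (x + s *\<^sub>R h) h \<bullet> h)"
      using MVT2[of 0 t "\<lambda>t. G (x + t *\<^sub>R h) \<bullet> h" "\<lambda>t. H (x + t *\<^sub>R h) h \<bullet> h"] dG t(1) by auto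
    let ?z = "x + s *\<^sub>R h"
    have nz: "norm (s *\<^sub>R h) \<le> norm h"
      using s t by (simp add: mult_left_le_one_le)
    have zin: "?z \<in> cball 0 (B + 1)" "x \<in> cball 0 (B + 1)"
      using norm_triangle_ineq[of x "s *\<^sub>R h"] nz x y by (auto simp: h_def)
    have "dist ?z x < d" using nz y by (simp add: dist_norm h_def)
    then have "dist (H ?z) (H x) < \<eta>" using d zin by blast
    then have "norm (H ?z - H x) \<le> \<eta>" by (simp add: dist_norm)
    then have "norm ((H ?z - H x) h) \<le> \<eta> * norm h"
      by (meson mult_right_mono norm_blinfun norm_ge_zero order_trans)
    then have "\<bar>(H ?z - H x) h \<bullet> h\<bar> \<le> \<eta> * norm h * norm h"
      by (meson Cauchy_Schwarz_ineq2 mult_right_mono norm_ge_zero order_trans)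
    moreover have "0 \<le> H x h \<bullet> h"
      using psd by (simp add: positive_semidefinite_def inner_commute)
    ultimately have Hz: "- (\<eta> * (norm h)\<^sup>2) \<le> H ?z h \<bullet> h"
      by (simp add: blinfun.diff_left inner_diff_left power2_eq_square abs_le_iff)
    have "- (\<eta> * (norm h)\<^sup>2) \<le> t * (H ?z h \<bullet> h)"
    proof (cases "0 \<le> H ?z h \<bullet> h")
      case True
      have "- (\<eta> * (norm h)\<^sup>2) \<le> 0" using \<open>\<eta> > 0\<close> by simp
      also have "0 \<le> t * (H ?z h \<bullet> h)" using True t by simp
      finally show ?thesis .
    next
      case False
      then have "1 * (H ?z h \<bullet> h) \<le> t * (H ?z h \<bullet> h)"
        using t by (intro mult_right_mono_neg) auto
      then show ?thesis using Hz by simp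
    qed
    then show "v x \<le> v y + \<eta> * (norm (y - x))\<^sup>2"
      using t(3) s(3) G0 by (simp add: h_def)
  qed (use d in auto)
qed

context radial_kernel
begin

context
  fixes \<rho> :: "'a measure" and B :: real and u v :: 'a
  assumes LIC: "LIC W" and \<rho>: "\<rho> \<in> borel_prob" and B: "AE x in \<rho>. norm x \<le> B"
    and ab: "orthonormal_pair u v" and fin: "cross_energy \<rho> \<rho> < \<infinity>"
begin

abbreviation "rotate_by t \<equiv> about (center_of_mass \<rho>) (plane_rotation u v t)"
abbreviation "rotated t \<equiv> distr \<rho> borel (rotate_by t)"

lemma rotate_by: "rotate_by t \<in> borel \<rightarrow>\<^sub>M borel" "norm (rotate_by t x - rotate_by t y) = norm (x - y)"
  using about_orthogonal[OF orthogonal_plane_rotation[OF ab]] by auto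

lemma rotated_prob: "rotated t \<in> borel_prob"
  using \<rho> rotate_by(1) by (rule borel_prob_distr)

lemma rotated_rotated: "distr (rotated s) borel (rotate_by t) = rotated (t + s)"
proof -
  have m: "rotate_by s \<in> \<rho> \<rightarrow>\<^sub>M borel"
    using rotate_by(1) borel_probD(2)[OF \<rho>] by (simp cong: measurable_cong_sets)
  have "rotate_by t \<circ> rotate_by s = rotate_by (t + s)"
    by (auto simp: about_def plane_rotation_add[OF ab])
  then show ?thesis by (simp only: distr_distr[OF rotate_by(1) m])
qed

lemma rotated_zero: "rotated 0 = \<rho>"
proof -
  have "rotate_by 0 = (\<lambda>x. x)" by (auto simp: about_def plane_rotation_zero)
  then show ?thesis using borel_probD(2)[OF \<rho>] by (simp add: distr_id2)
qed

lemma cross_rotated: "cross_energy (rotated (s + r)) (rotated (s + t)) = cross_energy (rotated r) (rotated t)"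
  using cross_energy_isometry[OF rotated_prob[of r] rotated_prob[of t] rotate_by(1)[of s] rotate_by(2)]
  by (simp only: rotated_rotated)

lemma rotated_bounded: "AE x in rotated t. norm x \<le> B + 2 * norm (center_of_mass \<rho>)"
  by (rule AE_bounded_about[OF borel_probD(2)[OF \<rho>] orthogonal_plane_rotation[OF ab] B])

lemma rotated_prob2: "rotated t \<in> borel_prob2" "integrable (rotated t) (\<lambda>x. x)"
  using borel_prob2_of_bounded[OF rotated_prob rotated_bounded] .

lemma base_prob2: "\<rho> \<in> borel_prob2" "integrable \<rho> (\<lambda>x. x)"
  using borel_prob2_of_bounded[OF \<rho> B] .

lemma center_rotated: "center_of_mass (rotated t) = center_of_mass \<rho>"
  by (rule center_of_mass_about[OF \<rho> base_prob2(2) orthogonal_plane_rotation[OF ab]])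

lemma cross_rotated_self: "cross_energy (rotated t) (rotated t) = cross_energy \<rho> \<rho>"
  by (rule cross_energy_isometry[OF \<rho> \<rho> rotate_by])

lemma cross_rotated_finite: "cross_energy \<rho> (rotated t) < \<infinity>"
proof -
  have "2 * cross_energy \<rho> (rotated t) \<le> cross_energy \<rho> \<rho> + cross_energy \<rho> \<rho>"
    using LIC_cross_energy_le[OF LIC base_prob2(1) rotated_prob2(1) center_rotated[symmetric] fin]
    by (simp only: cross_rotated_self fin simp_thms)
  also have "\<dots> < \<infinity>" using fin by simp
  finally show ?thesis by (auto simp: ennreal_mult_less_top ennreal_mult_eq_top_iff top.not_eq_extremum[symmetric])
qed

text \<open>Since \<open>\<rho>\<close> and \<open>\<rho>\<^sub>t\<close> have the same self-energy, this is half the value of the quadratic form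
  on \<open>\<rho> - \<rho>\<^sub>t\<close>.\<close>

definition defect :: "real \<Rightarrow> real" where
  "defect t = enn2real (cross_energy \<rho> \<rho>) - enn2real (cross_energy \<rho> (rotated t))"

text \<open>Positivity of the form on the second difference \<open>\<rho>\<^sub>t + \<rho>\<^sub>-\<^sub>t - 2 \<rho>\<close>, whose energy involves
  only the angles \<open>t\<close> and \<open>2 t\<close> by rotation invariance.\<close>

lemma defect_double: "defect (2 * t) \<le> 4 * defect t"
proof -
  let ?m = "mix_measure (1/2) (rotated t) (1/2) (rotated (- t))"
  note p = rotated_prob[of t] rotated_prob[of "- t"]
  have m: "?m \<in> borel_prob" by (intro borel_prob_mix p) auto
  have "AE x in ?m. norm x \<le> B + 2 * norm (center_of_mass \<rho>)"
    by (intro AE_mix_measure rotated_bounded) auto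
  note m2 = borel_prob2_of_bounded[OF m this]
  have cm: "center_of_mass ?m = center_of_mass \<rho>"
    using center_of_mass_mix[OF p(1) rotated_prob2(2) p(2) rotated_prob2(2) m2(2)]
    by (simp add: center_rotated scaleR_2[symmetric] flip: scaleR_add_left)
  obtain A0 where A0: "0 \<le> A0" "cross_energy \<rho> \<rho> = ennreal A0"
    using fin by (cases "cross_energy \<rho> \<rho>") auto
  obtain A1 where A1: "0 \<le> A1" "cross_energy \<rho> (rotated t) = ennreal A1"
    using cross_rotated_finite[of t] by (cases "cross_energy \<rho> (rotated t)") auto
  obtain A2 where A2: "0 \<le> A2" "cross_energy \<rho> (rotated (2 * t)) = ennreal A2"
    using cross_rotated_finite[of "2 * t"] by (cases "cross_energy \<rho> (rotated (2 * t))") auto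
  have pm: "cross_energy (rotated (- t)) (rotated t) = ennreal A2"
    using cross_rotated[of t "- t" t]
    unfolding add.right_inverse rotated_zero mult_2[symmetric] A2(2) by (rule sym)
  have mt: "cross_energy \<rho> (rotated (- t)) = ennreal A1"
    using cross_rotated[of t 0 "- t"]
    unfolding add_0_right add.right_inverse rotated_zero
      cross_energy_commute[OF rotated_prob[of t] \<rho>] A1(2) by (rule sym)
  have half: "ennreal (1/2) * ennreal x + ennreal (1/2) * ennreal y = ennreal (1/2 * x + 1/2 * y)"
    if "0 \<le> x" "0 \<le> y" for x y
  proof -
    have "(0::real) \<le> 1/2" by simp
    then show ?thesis
      using that by (simp only: ennreal_mult ennreal_plus mult_nonneg_nonneg)
  qed
  have rm: "cross_energy \<rho> ?m = ennreal A1"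
    unfolding cross_energy_mix_right[OF \<rho> p] A1(2) mt using half[OF A1(1) A1(1)] by simp
  have "cross_energy (rotated t) ?m = ennreal (1/2 * A0 + 1/2 * A2)"
    unfolding cross_energy_mix_right[OF p(1) p] cross_rotated_self A0(2)
      cross_energy_commute[OF p(1) p(2)] pm by (rule half[OF A0(1) A2(1)])
  moreover have "cross_energy (rotated (- t)) ?m = ennreal (1/2 * A2 + 1/2 * A0)"
    unfolding cross_energy_mix_right[OF p(2) p] cross_rotated_self A0(2) pm
    by (rule half[OF A2(1) A0(1)])
  ultimately have mm: "cross_energy ?m ?m = ennreal (1/2 * A0 + 1/2 * A2)"
    unfolding cross_energy_mix_right[OF m p] cross_energy_commute[OF m p(1)] cross_energy_commute[OF m p(2)]
    using half[of "1/2 * A0 + 1/2 * A2" "1/2 * A2 + 1/2 * A0"] A0(1) A2(1) by (simp add: add.commute)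
  have "2 * cross_energy \<rho> ?m \<le> cross_energy \<rho> \<rho> + cross_energy ?m ?m"
    by (rule LIC_cross_energy_le[OF LIC base_prob2(1) m2(1) cm[symmetric] fin]) (simp add: mm)
  moreover have "2 * ennreal A1 = ennreal (2 * A1)"
    using A1(1) by (simp add: ennreal_mult)
  moreover have "ennreal A0 + ennreal (1/2 * A0 + 1/2 * A2) = ennreal (A0 + (1/2 * A0 + 1/2 * A2))"
    using A0(1) A2(1) by (intro ennreal_plus[symmetric]) auto
  ultimately have "ennreal (2 * A1) \<le> ennreal (A0 + (1/2 * A0 + 1/2 * A2))"
    by (simp only: rm mm A0(2))
  then have "2 * A1 \<le> A0 + (1/2 * A0 + 1/2 * A2)"
    using A0(1) A1(1) A2(1) by (subst (asm) ennreal_le_iff) auto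
  then show ?thesis using A0 A1 A2 by (simp add: defect_def)
qed

lemma defect_pow: "defect (2 ^ n * t) \<le> 4 ^ n * defect t"
proof (induction n)
  case (Suc n)
  then show ?case using defect_double[of "2 ^ n * t"] by (simp add: mult.assoc)
qed simp

text \<open>By \<open>defect t \<le> 4\<^sup>n defect (t / 2\<^sup>n)\<close>, an upper bound \<open>o(t\<^sup>2)\<close> near \<open>0\<close> makes the defect
  nonpositive for all angles, which strict positivity allows only if \<open>\<rho>\<^sub>t = \<rho>\<close>.\<close>

lemma rotated_eq_of_small_defect:
  assumes small: "\<And>\<eta>. \<eta> > 0 \<Longrightarrow> \<exists>\<delta>>0. \<forall>s. \<bar>s\<bar> < \<delta> \<longrightarrow> defect s \<le> \<eta> * s\<^sup>2"
  shows "rotated t = \<rho>"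
proof (rule ccontr)
  assume ne: "rotated t \<noteq> \<rho>"
  have bd: "defect t \<le> \<eta> * t\<^sup>2" if \<eta>: "\<eta> > 0" for \<eta>
  proof -
    obtain \<delta> where \<delta>: "\<delta> > 0" "\<And>s. \<bar>s\<bar> < \<delta> \<Longrightarrow> defect s \<le> \<eta> * s\<^sup>2"
      using small[OF \<eta>] by blast
    obtain n where n: "\<bar>t / 2 ^ n\<bar> < \<delta>" using ex_small_halving[OF \<open>\<delta> > 0\<close>] .
    have "defect t \<le> 4 ^ n * defect (t / 2 ^ n)"
      using defect_pow[of n "t / 2 ^ n"] by simp
    also have "\<dots> \<le> 4 ^ n * (\<eta> * (t / 2 ^ n)\<^sup>2)"
      using \<delta>(2)[OF n] by (intro mult_left_mono) auto
    also have "\<dots> = \<eta> * t\<^sup>2"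
      by (simp add: power_divide power2_eq_square flip: power_mult_distrib)
    finally show ?thesis .
  qed
  have "defect t \<le> 0"
  proof (rule field_le_epsilon)
    fix e :: real assume "e > 0"
    have "defect t \<le> e / (t\<^sup>2 + 1) * t\<^sup>2" using \<open>e > 0\<close> by (intro bd) (simp add: add_nonneg_pos)
    also have "\<dots> \<le> e"
    proof -
      have "t\<^sup>2 / (t\<^sup>2 + 1) \<le> 1" by (simp add: divide_le_eq_1 add_nonneg_pos)
      from mult_left_mono[OF this, of e] show ?thesis using \<open>e > 0\<close> by simp
    qed
    finally show "defect t \<le> 0 + e" by simp
  qed
  then have le: "enn2real (cross_energy \<rho> \<rho>) \<le> enn2real (cross_energy \<rho> (rotated t))"
    by (simp add: defect_def)
  have "cross_energy \<rho> \<rho> \<le> cross_energy \<rho> (rotated t)"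
    using ennreal_leI[OF le]
    unfolding ennreal_enn2real[OF fin[unfolded infinity_ennreal_def]]
      ennreal_enn2real[OF cross_rotated_finite[of t, unfolded infinity_ennreal_def]] .
  then have "cross_energy \<rho> \<rho> + cross_energy \<rho> \<rho> \<le> 2 * cross_energy \<rho> (rotated t)"
    by (simp add: mult_2 add_mono)
  moreover have "2 * cross_energy \<rho> (rotated t) < cross_energy \<rho> \<rho> + cross_energy \<rho> \<rho>"
    using LIC_cross_energy[OF LIC base_prob2(1) rotated_prob2(1) ne[symmetric] center_rotated[symmetric] fin]
    by (simp only: cross_rotated_self fin simp_thms)
  ultimately show False by simp
qed

end

text \<open>The defect equals \<open>- \<integral> (V (R\<^sub>t x) - V x) d\<rho> x\<close>, which Taylor expansion at the
  critical points of \<open>V\<close> bounds by \<open>o(t\<^sup>2)\<close>.\<close>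

lemma steady_state_rotation_invariant:
  assumes LIC: "LIC W" and \<rho>: "\<rho> \<in> borel_prob" "compactly_supported \<rho>"
    and steady: "steady_state W \<rho>"
    and hess: "has_hessian (potential W \<rho>) H" and H: "continuous_on UNIV H"
    and psd: "\<forall>x\<in>msupp \<rho>. positive_semidefinite (H x)" and ab: "orthonormal_pair a b'"
  shows "distr \<rho> borel (about (center_of_mass \<rho>) (plane_rotation a b' t)) = \<rho>"
proof -
  note r = borel_probD[OF \<rho>(1)]
  interpret prob_space \<rho> by fact
  have [measurable_cong]: "sets \<rho> = sets borel" by fact
  let ?c = "center_of_mass \<rho>"
  obtain B where B: "AE x in \<rho>. norm x \<le> B"
    using compactly_supportedE[OF \<rho>] .
  obtain V G where V: "\<And>x. potential W \<rho> x = ereal (V x)"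
    and dV: "\<And>x. (V has_derivative (\<lambda>h. G x \<bullet> h)) (at x)"
    and dG: "\<And>x. (G has_derivative blinfun_apply (H x)) (at x)"
    using hess unfolding has_hessian_def by blast
  have pot: "b \<le> V x" "shifted_potential \<rho> x = ennreal (V x - b)" for x
  proof -
    have e: "enn2ereal (shifted_potential \<rho> x) + ereal b = ereal (V x)"
      using potential_eq[OF \<rho>(1)] V by metis
    obtain p where "0 \<le> p" "shifted_potential \<rho> x = ennreal p"
      using e by (cases "shifted_potential \<rho> x") auto
    then show "b \<le> V x" "shifted_potential \<rho> x = ennreal (V x - b)" using e by auto
  qed
  have contV: "continuous_on UNIV V"
    using dV by (intro continuous_at_imp_continuous_on ballI has_derivative_continuous)
  note [measurable] = shifted_potential_measurable[OF \<rho>(1)]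
  have crit: "AE x in \<rho>. G x = 0 \<and> positive_semidefinite (H x) \<and> norm x \<le> B"
    using steady[unfolded steady_state_def] AE_in_msupp[OF r(2)] B
  proof eventually_elim
    case (elim x)
    then show ?case using gradient_zero_of_subdifferential[OF V dV] psd by blast
  qed
  have fin: "cross_energy \<rho> \<rho> < \<infinity>"
  proof -
    have "bounded (V ` cball 0 B)"
      by (intro compact_imp_bounded compact_continuous_image continuous_on_subset[OF contV]) auto
    then obtain C where C: "\<And>x. norm x \<le> B \<Longrightarrow> \<bar>V x\<bar> \<le> C" by (force simp: bounded_iff)
    have "cross_energy \<rho> \<rho> \<le> (\<integral>\<^sup>+x. ennreal (C - b) \<partial>\<rho>)"
      unfolding cross_energy_def
    proof (rule nn_integral_mono_AE)
      show "AE x in \<rho>. shifted_potential \<rho> x \<le> ennreal (C - b)"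
        using B by eventually_elim (use C in \<open>auto simp: pot abs_le_iff intro!: ennreal_leI\<close>)
    qed
    also have "\<dots> < \<infinity>" by (simp add: emeasure_space_1)
    finally show ?thesis .
  qed
  have "\<exists>\<delta>>0. \<forall>s. \<bar>s\<bar> < \<delta> \<longrightarrow> defect \<rho> a b' s \<le> \<eta> * s\<^sup>2" if \<eta>: "\<eta> > 0" for \<eta>
  proof -
    define K where "K = 4 * (\<bar>B\<bar> + norm ?c) + 1"
    have K: "K > 0" unfolding K_def by (simp add: add_nonneg_pos)
    obtain d where d: "d > 0" "\<And>x y. norm x \<le> B \<Longrightarrow> norm (y - x) < d \<Longrightarrow> G x = 0 \<Longrightarrow>
        positive_semidefinite (H x) \<Longrightarrow> V x \<le> V y + \<eta> / K\<^sup>2 * (norm (y - x))\<^sup>2"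
      using taylor_lower_bound[OF dV dG H, of "\<eta> / K\<^sup>2" B] \<open>\<eta> > 0\<close> K by auto
    have "defect \<rho> a b' s \<le> \<eta> * s\<^sup>2" if s: "\<bar>s\<bar> < d / K" for s
    proof -
      let ?T = "about ?c (plane_rotation a b' s)"
      have T[measurable]: "?T \<in> borel \<rightarrow>\<^sub>M borel"
        by (rule about_orthogonal(1)[OF orthogonal_plane_rotation[OF ab]])
      note p = borel_prob_distr[OF \<rho>(1) T]
      have "AE x in \<rho>. shifted_potential \<rho> x \<le> shifted_potential \<rho> (?T x) + ennreal (\<eta> * s\<^sup>2)"
        using crit
      proof eventually_elim
        case (elim x)
        have n: "norm (?T x - x) \<le> K * \<bar>s\<bar>"
          unfolding K_def using elim by (intro about_rotation_displacement[OF ab]) auto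
        also have "\<dots> < d" using s K by (simp add: field_simps)
        finally have "V x \<le> V (?T x) + \<eta> / K\<^sup>2 * (norm (?T x - x))\<^sup>2" using d(2) elim by blast
        also have "\<eta> / K\<^sup>2 * (norm (?T x - x))\<^sup>2 \<le> \<eta> / K\<^sup>2 * (K * \<bar>s\<bar>)\<^sup>2"
          using n \<open>\<eta> > 0\<close> by (intro mult_left_mono power_mono) auto
        also have "\<dots> = \<eta> * s\<^sup>2" using K by (simp add: power_mult_distrib)
        finally have "V x - b \<le> (V (?T x) - b) + \<eta> * s\<^sup>2" by simp
        then have "ennreal (V x - b) \<le> ennreal ((V (?T x) - b) + \<eta> * s\<^sup>2)" by (rule ennreal_leI)
        also have "\<dots> = ennreal (V (?T x) - b) + ennreal (\<eta> * s\<^sup>2)"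
          using pot(1)[of "?T x"] \<open>\<eta> > 0\<close> by (intro ennreal_plus) auto
        finally show ?case by (simp add: pot)
      qed
      then have "cross_energy \<rho> \<rho> \<le> (\<integral>\<^sup>+x. shifted_potential \<rho> (?T x) + ennreal (\<eta> * s\<^sup>2) \<partial>\<rho>)"
        unfolding cross_energy_def by (rule nn_integral_mono_AE)
      also have "\<dots> = (\<integral>\<^sup>+x. shifted_potential \<rho> (?T x) \<partial>\<rho>) + ennreal (\<eta> * s\<^sup>2)"
        by (subst nn_integral_add) (auto simp: emeasure_space_1)
      also have "(\<integral>\<^sup>+x. shifted_potential \<rho> (?T x) \<partial>\<rho>) = cross_energy (distr \<rho> borel ?T) \<rho>"
        unfolding cross_energy_def by (subst nn_integral_distr) auto
      also have "\<dots> = cross_energy \<rho> (distr \<rho> borel ?T)"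
        by (rule cross_energy_commute[OF p \<rho>(1)])
      finally have "enn2real (cross_energy \<rho> \<rho>) \<le>
          enn2real (cross_energy \<rho> (distr \<rho> borel ?T) + ennreal (\<eta> * s\<^sup>2))"
        using cross_rotated_finite[OF LIC \<rho>(1) B ab fin, of s] by (intro enn2real_mono) auto
      also have "\<dots> = enn2real (cross_energy \<rho> (distr \<rho> borel ?T)) + \<eta> * s\<^sup>2"
        using cross_rotated_finite[OF LIC \<rho>(1) B ab fin, of s] \<open>\<eta> > 0\<close> by (subst enn2real_plus) auto
      finally show ?thesis by (simp add: defect_def[OF LIC \<rho>(1) B ab fin])
    qed
    then show ?thesis using d(1) K by (intro exI[of _ "d / K"]) auto
  qed
  from rotated_eq_of_small_defect[OF LIC \<rho>(1) B ab fin this] show ?thesis .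
qed

end

section \<open>Radial symmetry of local minimizers and steady states\<close>

theorem theorem3p1:
  fixes W :: "'a::euclidean_space \<Rightarrow> ereal"
  assumes "DIM('a) \<ge> 2"
    and "locally_integrable W"
    and "\<exists>b::real. \<forall>x. ereal b \<le> W x"
    and "lower_semicontinuous W"
    and "radial_fun W"
    and "LIC W"
  shows "(\<forall>\<rho>\<in>borel_prob. compactly_supported \<rho> \<and> d_inf_local_minimizer W \<rho> \<longrightarrow>
            radial_about (center_of_mass \<rho>) \<rho>) \<and>
         (FLIC W \<longrightarrow>
            (\<forall>\<rho>\<in>borel_prob. compactly_supported \<rho> \<and> steady_state W \<rho> \<and>
               (\<exists>H. has_hessian (potential W \<rho>) H \<and> continuous_on UNIV H \<and>
                    (\<forall>x\<in>msupp \<rho>. positive_semidefinite (H x))) \<longrightarrow>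
               radial_about (center_of_mass \<rho>) \<rho>))"
proof -
  obtain b :: real where b: "\<And>x. ereal b \<le> W x" using assms(3) by blast
  have "ereal (min b 0) \<le> W x" for x
    using b[of x] by (meson ereal_less_eq(3) min.cobounded1 order_trans)
  then interpret radial_kernel W "min b 0"
    using assms(2,5) by unfold_locales (auto simp: locally_integrable_def)
  show ?thesis
  proof (intro conjI impI ballI; elim conjE exE)
    fix \<rho> :: "'a measure"
    assume \<rho>: "\<rho> \<in> borel_prob" "compactly_supported \<rho>" and min: "d_inf_local_minimizer W \<rho>"
    show "radial_about (center_of_mass \<rho>) \<rho>"
      by (rule radial_about_of_plane_rotations[OF assms(1) borel_probD(1,2)[OF \<rho>(1)]])
        (rule local_minimizer_rotation_invariant[OF assms(2,6) \<rho> min])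
  next
    fix \<rho> :: "'a measure" and H
    assume \<rho>: "\<rho> \<in> borel_prob" "compactly_supported \<rho>" and steady: "steady_state W \<rho>"
      and H: "has_hessian (potential W \<rho>) H" "continuous_on UNIV H"
        "\<forall>x\<in>msupp \<rho>. positive_semidefinite (H x)"
    show "radial_about (center_of_mass \<rho>) \<rho>"
      by (rule radial_about_of_plane_rotations[OF assms(1) borel_probD(1,2)[OF \<rho>(1)]])
        (rule steady_state_rotation_invariant[OF assms(6) \<rho> steady H])
  qed
qed

end
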